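(* There is an algorithm that, given a bipartite distance-hereditary graph $G$, returns a Grundy total dominating sequence of $G$ in time $O(|V(G)|(|V(G)|+|E(G)|))$.
   Context: All graphs are finite and simple. A graph $G$ is distance-hereditary if for every connected induced subgraph $G'$ of $G$ and all $x,y\in V(G')$, the distance between $x$ and $y$ in $G'$ equals their distance in $G$; it is bipartite distance-hereditary if it is moreover bipartite. For a vertex $v$, $N(v)$ is its open neighborhood. A sequence $(v_1,\ldots,v_k)$ of distinct vertices is legal if for every $i\in\{1,\ldots,k\}$, $N(v_i)\setminus\bigcup_{j=1}^{i-1}N(v_j)\neq\emptyset$ (the empty sequence is legal). The Grundy total domination number $\gamma_{\rm gr}^t(G)$ is the maximum length of a legal sequence, and a legal sequence of this length is a Grundy total dominating sequence (if $G$ has no edges, this is the empty sequence). *)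

theory Defs
  imports Main
begin

section \<open>Finite simple graphs\<close>

definition simple_graph :: "'a set \<Rightarrow> 'a set set \<Rightarrow> bool" where
  "simple_graph V E \<longleftrightarrow> finite V \<and> (\<forall>e\<in>E. e \<subseteq> V \<and> card e = 2)"

definition nbhd :: "'a set set \<Rightarrow> 'a \<Rightarrow> 'a set" where
  "nbhd E v = {u. {v, u} \<in> E}"

definition adj_rel :: "'a set set \<Rightarrow> ('a \<times> 'a) set" where
  "adj_rel E = {(u, v). {u, v} \<in> E}"

definition induced_edges :: "'a set set \<Rightarrow> 'a set \<Rightarrow> 'a set set" where
  "induced_edges E W = {e \<in> E. e \<subseteq> W}"

definition connected_graph :: "'a set \<Rightarrow> 'a set set \<Rightarrow> bool" where
  "connected_graph V E \<longleftrightarrow> (\<forall>x\<in>V. \<forall>y\<in>V. (x, y) \<in> (adj_rel E)\<^sup>*)"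

text \<open>The least length of a walk from \<open>x\<close> to \<open>y\<close>.  The value is meaningful only if the two
  vertices lie in one component; below it is applied only to such pairs.\<close>

definition gdist :: "'a set set \<Rightarrow> 'a \<Rightarrow> 'a \<Rightarrow> nat" where
  "gdist E x y = (LEAST k. (x, y) \<in> adj_rel E ^^ k)"

definition distance_hereditary :: "'a set \<Rightarrow> 'a set set \<Rightarrow> bool" where
  "distance_hereditary V E \<longleftrightarrow>
     (\<forall>W\<subseteq>V. connected_graph W (induced_edges E W) \<longrightarrow>
        (\<forall>x\<in>W. \<forall>y\<in>W. gdist (induced_edges E W) x y = gdist E x y))"

definition bipartite :: "'a set \<Rightarrow> 'a set set \<Rightarrow> bool" where
  "bipartite V E \<longleftrightarrow>
     (\<exists>A B. A \<union> B = V \<and> A \<inter> B = {} \<and> (\<forall>e\<in>E. \<exists>a\<in>A. \<exists>b\<in>B. e = {a, b}))"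

definition bipartite_distance_hereditary :: "'a set \<Rightarrow> 'a set set \<Rightarrow> bool" where
  "bipartite_distance_hereditary V E \<longleftrightarrow> bipartite V E \<and> distance_hereditary V E"


section \<open>Grundy total domination\<close>

definition legal_seq :: "'a set \<Rightarrow> 'a set set \<Rightarrow> 'a list \<Rightarrow> bool" where
  "legal_seq V E vs \<longleftrightarrow> set vs \<subseteq> V \<and> distinct vs \<and>
     (\<forall>i<length vs. nbhd E (vs ! i) - (\<Union>j<i. nbhd E (vs ! j)) \<noteq> {})"

definition grundy_total_number :: "'a set \<Rightarrow> 'a set set \<Rightarrow> nat" where
  "grundy_total_number V E = Max {length vs | vs. legal_seq V E vs}"

definition grundy_total_dom_seq :: "'a set \<Rightarrow> 'a set set \<Rightarrow> 'a list \<Rightarrow> bool" where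
  "grundy_total_dom_seq V E vs \<longleftrightarrow>
     legal_seq V E vs \<and> length vs = grundy_total_number V E"


section \<open>A random access machine\<close>

text \<open>
  Algorithms are structured programs for a random access machine with natural-number variables
  and natural-number arrays; a program mentions only finitely many of either.  The running time
  counts every node of every evaluated expression and every executed command.  The only
  operation that can produce a number larger than those already present, apart from the
  constants of the program, is the successor.  Hence numbers grow by at most one per time unit,
  so that in polynomial time all of them fit into words of logarithmically many bits, and
  the unit-cost measure agrees with that of a word RAM up to a constant factor.
\<close>

type_synonym name = string

record state =
  vars :: "name \<Rightarrow> nat"
  arrs :: "name \<Rightarrow> nat \<Rightarrow> nat"

datatype exp =
    Const nat
  | Var name
  | Elem name exp
  | Succ exp
  | Minus exp exp

datatype test =
    Less exp exp
  | Equal exp exp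
  | Neg test
  | Conj test test

datatype com =
    Skip
  | Assign name exp
  | Store name exp exp
  | Seq com com
  | Cond test com com
  | While test com

primrec eval_exp :: "exp \<Rightarrow> state \<Rightarrow> nat" where
  "eval_exp (Const k) s = k"
| "eval_exp (Var x) s = vars s x"
| "eval_exp (Elem a e) s = arrs s a (eval_exp e s)"
| "eval_exp (Succ e) s = Suc (eval_exp e s)"
| "eval_exp (Minus e f) s = eval_exp e s - eval_exp f s"

primrec cost_exp :: "exp \<Rightarrow> nat" where
  "cost_exp (Const k) = 1"
| "cost_exp (Var x) = 1"
| "cost_exp (Elem a e) = 1 + cost_exp e"
| "cost_exp (Succ e) = 1 + cost_exp e"
| "cost_exp (Minus e f) = 1 + cost_exp e + cost_exp f"

primrec eval_test :: "test \<Rightarrow> state \<Rightarrow> bool" where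
  "eval_test (Less e f) s \<longleftrightarrow> eval_exp e s < eval_exp f s"
| "eval_test (Equal e f) s \<longleftrightarrow> eval_exp e s = eval_exp f s"
| "eval_test (Neg b) s \<longleftrightarrow> \<not> eval_test b s"
| "eval_test (Conj b c) s \<longleftrightarrow> eval_test b s \<and> eval_test c s"

primrec cost_test :: "test \<Rightarrow> nat" where
  "cost_test (Less e f) = 1 + cost_exp e + cost_exp f"
| "cost_test (Equal e f) = 1 + cost_exp e + cost_exp f"
| "cost_test (Neg b) = 1 + cost_test b"
| "cost_test (Conj b c) = 1 + cost_test b + cost_test c"

text \<open>\<open>exec c s T t\<close>: started in \<open>s\<close>, the program \<open>c\<close> halts in \<open>t\<close> after exactly \<open>T\<close> time units.\<close>

inductive exec :: "com \<Rightarrow> state \<Rightarrow> nat \<Rightarrow> state \<Rightarrow> bool" where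
  Skip: "exec Skip s 1 s"
| Assign: "exec (Assign x e) s (1 + cost_exp e)
     (s\<lparr>vars := (vars s)(x := eval_exp e s)\<rparr>)"
| Store: "exec (Store a e f) s (1 + cost_exp e + cost_exp f)
     (s\<lparr>arrs := (arrs s)(a := (arrs s a)(eval_exp e s := eval_exp f s))\<rparr>)"
| Seq: "exec c s T s' \<Longrightarrow> exec d s' T' t \<Longrightarrow> exec (Seq c d) s (T + T') t"
| CondTrue: "eval_test b s \<Longrightarrow> exec c s T t \<Longrightarrow>
     exec (Cond b c d) s (1 + cost_test b + T) t"
| CondFalse: "\<not> eval_test b s \<Longrightarrow> exec d s T t \<Longrightarrow>
     exec (Cond b c d) s (1 + cost_test b + T) t"
| WhileFalse: "\<not> eval_test b s \<Longrightarrow> exec (While b c) s (1 + cost_test b) s"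
| WhileTrue: "eval_test b s \<Longrightarrow> exec c s T s' \<Longrightarrow> exec (While b c) s' T' t \<Longrightarrow>
     exec (While b c) s (1 + cost_test b + T + T') t"

lemma exec_deterministic:
  "exec c s T t \<Longrightarrow> exec c s T' t' \<Longrightarrow> T' = T \<and> t' = t"
proof (induction arbitrary: T' t' rule: exec.induct)
  case (Seq c s T s1 d T1 t)
  from Seq.prems show ?case by cases (use Seq.IH in blast)
next
  case (WhileTrue b s c T s1 T1 t)
  from WhileTrue.prems show ?case by cases (use WhileTrue.IH WhileTrue.hyps in blast)+
qed (erule exec.cases; force)+

text \<open>
  The input is an adjacency-list representation of a graph with vertices \<open>0, \<dots>, n - 1\<close>:
  the neighbours of \<open>v\<close> are stored in \<open>adj\<close>, each exactly once and in an arbitrary order, at the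
  positions from \<open>off[v]\<close> up to but excluding \<open>off[v + 1]\<close>.  So \<open>off[n]\<close> is twice the number
  of edges.  Everything else is initially zero.
\<close>

definition graph_input :: "nat \<Rightarrow> nat set set \<Rightarrow> state \<Rightarrow> bool" where
  "graph_input n E s \<longleftrightarrow>
     vars s = (\<lambda>_. 0)(''n'' := n) \<and>
     arrs s ''off'' 0 = 0 \<and>
     (\<forall>v<n. arrs s ''off'' v \<le> arrs s ''off'' (Suc v) \<and>
        bij_betw (arrs s ''adj'') {arrs s ''off'' v..<arrs s ''off'' (Suc v)} (nbhd E v)) \<and>
     (\<forall>i>n. arrs s ''off'' i = 0) \<and>
     (\<forall>i\<ge>arrs s ''off'' n. arrs s ''adj'' i = 0) \<and>
     (\<forall>a. a \<noteq> ''off'' \<and> a \<noteq> ''adj'' \<longrightarrow> arrs s a = (\<lambda>_. 0))"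

definition seq_output :: "state \<Rightarrow> nat list" where
  "seq_output t = map (arrs t ''seq'') [0..<vars t ''len'']"

end

theory Submission imports Defs begin

text \<open>
  If the neighbours \<open>U\<close> of a vertex \<open>x\<close> in an induced subgraph \<open>W\<close> are pairwise twins and \<open>u \<in> U\<close>,
  then the Grundy total domination number of \<open>W\<close> exceeds that of \<open>W - {x} - U\<close> by exactly two, and
  placing \<open>x\<close> before and \<open>u\<close> after an optimal sequence of the smaller graph is optimal for \<open>W\<close>.

  In a bipartite distance-hereditary graph with breadth-first search levels, two vertices of
  one level with a common neighbour one level above have the same neighbours one level below, and
  the neighbourhoods of the vertices of a level in the level below form a laminar family.  Both
  facts are inherited by every vertex set \<open>W\<close>, although the levels refer to the whole graph.
  Therefore a non-isolated vertex of \<open>W\<close> of largest level and, on that level, of smallest degree in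
  \<open>W\<close> has pairwise twin neighbours.  So one computation of the levels suffices, and each of the at
  most \<open>n\<close> eliminations takes linear time.
\<close>

section \<open>Level structures of bipartite distance-hereditary graphs\<close>

lemma adj_rel_iff: "(u, v) \<in> adj_rel E \<longleftrightarrow> {u, v} \<in> E"
  by (simp add: adj_rel_def)

lemma adj_rel_induced_iff:
  "(u, v) \<in> adj_rel (induced_edges E X) \<longleftrightarrow> {u, v} \<in> E \<and> u \<in> X \<and> v \<in> X"
  by (simp add: adj_rel_def induced_edges_def)

lemma sym_adj_rel: "sym (adj_rel E)"
  by (auto simp: sym_def adj_rel_def insert_commute)

text \<open>Distance heredity speaks only of connected induced subgraphs, while \<open>X\<close> may
  induce a disconnected one. It is therefore applied to the component \<open>W\<close> of
  \<open>x\<close> in \<open>X\<close>, where a shortest walk is also a walk inside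
  \<open>X\<close>.\<close>

lemma distance_hereditary_walk:
  assumes dh: "distance_hereditary V E" and X: "X \<subseteq> V" and x: "x \<in> X"
    and conn: "(x, y) \<in> (adj_rel (induced_edges E X))\<^sup>*"
    and walk: "(x, y) \<in> adj_rel E ^^ m"
  obtains k where "k \<le> m" "(x, y) \<in> adj_rel (induced_edges E X) ^^ k"
proof -
  let ?R = "adj_rel (induced_edges E X)"
  define W where "W = {v. (x, v) \<in> ?R\<^sup>*}"
  have "v \<in> X" if "(x, v) \<in> ?R\<^sup>*" for v
    using that x by (induction) (auto simp: adj_rel_induced_iff)
  then have WX: "W \<subseteq> X" by (auto simp: W_def)
  have xW: "x \<in> W" and yW: "y \<in> W" using conn by (auto simp: W_def)
  have reach: "(x, v) \<in> (adj_rel (induced_edges E W))\<^sup>*" if "(x, v) \<in> ?R\<^sup>*" for v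
    using that
  proof (induction)
    case (step u v)
    then have "u \<in> W" "v \<in> W" by (auto simp: W_def intro: rtrancl_into_rtrancl)
    with step have "(u, v) \<in> adj_rel (induced_edges E W)" by (auto simp: adj_rel_induced_iff)
    with step.IH show ?case by (rule rtrancl_into_rtrancl)
  qed simp
  have "connected_graph W (induced_edges E W)"
    unfolding connected_graph_def
  proof (intro ballI)
    fix u v assume "u \<in> W" "v \<in> W"
    then have "(x, u) \<in> (adj_rel (induced_edges E W))\<^sup>*" "(x, v) \<in> (adj_rel (induced_edges E W))\<^sup>*"
      using reach by (auto simp: W_def)
    then show "(u, v) \<in> (adj_rel (induced_edges E W))\<^sup>*"
      by (meson rtrancl_trans sym_adj_rel sym_rtrancl symD)
  qed
  then have eq: "gdist (induced_edges E W) x y = gdist E x y"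
    using dh WX X xW yW unfolding distance_hereditary_def by (meson subset_trans)
  have "(x, y) \<in> (adj_rel (induced_edges E W))\<^sup>*" using reach yW by (auto simp: W_def)
  then obtain j where "(x, y) \<in> adj_rel (induced_edges E W) ^^ j"
    by (auto simp: rtrancl_power)
  then have "(x, y) \<in> adj_rel (induced_edges E W) ^^ gdist (induced_edges E W) x y"
    unfolding gdist_def by (rule LeastI)
  moreover have "adj_rel (induced_edges E W) \<subseteq> ?R"
    using WX by (auto simp: adj_rel_induced_iff)
  then have "adj_rel (induced_edges E W) ^^ j \<subseteq> ?R ^^ j" for j
    by (induction j) auto
  ultimately have "(x, y) \<in> ?R ^^ gdist E x y"
    unfolding eq by blast
  moreover have "gdist E x y \<le> m" using walk unfolding gdist_def by (rule Least_le)
  ultimately show thesis using that by blast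
qed

text \<open>The conditions on \<open>lev\<close> hold for breadth-first search levels when the levels of
  different components are shifted into disjoint intervals.\<close>

locale levelled_graph =
  fixes V :: "'a set" and E :: "'a set set" and lev :: "'a \<Rightarrow> nat"
  assumes simple: "simple_graph V E"
    and bdh: "bipartite_distance_hereditary V E"
    and lev_edge_le: "{u, v} \<in> E \<Longrightarrow> lev u \<le> Suc (lev v)"
    and lev_parent: "\<lbrakk>u \<in> V; v \<in> V; lev u = lev v; u \<noteq> v\<rbrakk> \<Longrightarrow> \<exists>w. {u, w} \<in> E \<and> lev u = Suc (lev w)"
begin

lemma edge_in: "{u, v} \<in> E \<Longrightarrow> u \<in> V \<and> v \<in> V \<and> u \<noteq> v"
  using simple by (force simp: simple_graph_def)

lemma edge_sym: "{u, v} \<in> E \<Longrightarrow> {v, u} \<in> E"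
  by (simp add: insert_commute)

text \<open>Bipartiteness only asserts that a bipartition exists; the choice fixes one proper
  2-colouring for the whole locale.\<close>

definition side :: "'a set" where
  "side = (SOME A. \<forall>u v. {u, v} \<in> E \<longrightarrow> (u \<in> A) \<noteq> (v \<in> A))"

lemma edge_side: "{u, v} \<in> E \<Longrightarrow> (u \<in> side) \<noteq> (v \<in> side)"
proof -
  obtain A B where AB: "A \<inter> B = {}" "\<forall>e\<in>E. \<exists>a\<in>A. \<exists>b\<in>B. e = {a, b}"
    using bdh unfolding bipartite_distance_hereditary_def bipartite_def by blast
  have "\<forall>u v. {u, v} \<in> E \<longrightarrow> (u \<in> A) \<noteq> (v \<in> A)"
    using AB by (fastforce simp: doubleton_eq_iff)
  then have "\<forall>u v. {u, v} \<in> E \<longrightarrow> (u \<in> side) \<noteq> (v \<in> side)"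
    unfolding side_def by (rule someI)
  then show "{u, v} \<in> E \<Longrightarrow> (u \<in> side) \<noteq> (v \<in> side)" by blast
qed

text \<open>Distinct vertices of one level both have neighbours one level lower, on the opposite
  sides, so the claim descends until the two vertices coincide.\<close>

lemma same_level_side: "\<lbrakk>u \<in> V; v \<in> V; lev u = lev v\<rbrakk> \<Longrightarrow> u \<in> side \<longleftrightarrow> v \<in> side"
proof (induction "lev u" arbitrary: u v rule: less_induct)
  case less
  show ?case
  proof (cases "u = v")
    case False
    then obtain w w' where "{u, w} \<in> E" "lev u = Suc (lev w)" "{v, w'} \<in> E" "lev v = Suc (lev w')"
      using lev_parent less.prems by metis
    moreover from this have "w \<in> side \<longleftrightarrow> w' \<in> side"
      using less edge_in by (metis lessI nat.inject)
    ultimately show ?thesis using edge_side by blast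
  qed simp
qed

text \<open>\<open>lev_edge_le\<close> in both directions leaves only equal levels to exclude, and
  these would put both ends on one side.\<close>

lemma lev_edge: "{u, v} \<in> E \<Longrightarrow> lev u = Suc (lev v) \<or> lev v = Suc (lev u)"
  using lev_edge_le[of u v] lev_edge_le[of v u] same_level_side[of u v] edge_in edge_side edge_sym
  by (metis le_SucE le_antisym)

text \<open>Distinct vertices of equal level can always be continued downwards, so descending chains
  from \<open>u\<close> and \<open>v\<close> have to meet, and they never rise above level
  \<open>d\<close>.\<close>

lemma same_level_connected:
  "\<lbrakk>u \<in> V; v \<in> V; lev u = lev v; lev u \<le> d\<rbrakk> \<Longrightarrow>
    (u, v) \<in> (adj_rel (induced_edges E {w \<in> V. lev w \<le> d}))\<^sup>*"
proof (induction "lev u" arbitrary: u v rule: less_induct)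
  case less
  let ?R = "adj_rel (induced_edges E {w \<in> V. lev w \<le> d})"
  show ?case
  proof (cases "u = v")
    case False
    then obtain w w' where w: "{u, w} \<in> E" "lev u = Suc (lev w)" "{v, w'} \<in> E" "lev v = Suc (lev w')"
      using lev_parent less.prems by metis
    have "(w, w') \<in> ?R\<^sup>*"
      using less.hyps[of w w'] w less.prems edge_in by (metis Suc_leD lessI nat.inject)
    moreover have "(u, w) \<in> ?R" "(w', v) \<in> ?R"
      using w less.prems edge_in by (auto simp: adj_rel_induced_iff insert_commute)
    ultimately show ?thesis
      by (meson converse_rtrancl_into_rtrancl rtrancl_into_rtrancl)
  qed simp
qed

section \<open>Distance heredity between consecutive levels\<close>

text \<open>In a bipartite graph the only possible chords of the path are \<open>{p1, p4}\<close>
  and \<open>{p2, p5}\<close>, so it is induced and its ends have distance 4 in it. The common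
  neighbour \<open>a\<close> brings them to distance 2 in the whole graph.\<close>

lemma induced_P5_ends_no_common_neighbour:
  assumes "{p1, p2} \<in> E" "{p2, p3} \<in> E" "{p3, p4} \<in> E" "{p4, p5} \<in> E"
    and "{p1, p4} \<notin> E" "{p2, p5} \<notin> E" "p1 \<noteq> p5" and "{p1, a} \<in> E" "{a, p5} \<in> E"
  shows False
proof -
  let ?X = "{p1, p2, p3, p4, p5}"
  let ?R = "adj_rel (induced_edges E ?X)"
  have "(p1, p2) \<in> ?R" "(p2, p3) \<in> ?R" "(p3, p4) \<in> ?R" "(p4, p5) \<in> ?R"
    using assms by (auto simp: adj_rel_induced_iff)
  then have "(p1, p5) \<in> ?R\<^sup>*" by (meson converse_rtrancl_into_rtrancl rtrancl.rtrancl_refl)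
  moreover have "?X \<subseteq> V" using assms edge_in by blast
  moreover have "(p1, p5) \<in> adj_rel E ^^ 2"
    using assms by (auto simp: numeral_2_eq_2 adj_rel_iff)
  ultimately obtain k where k: "k \<le> 2" "(p1, p5) \<in> ?R ^^ k"
    using distance_hereditary_walk[of V E ?X p1 p5 2] bdh
    by (auto simp: bipartite_distance_hereditary_def)
  have sides: "p1 \<in> side \<longleftrightarrow> p5 \<in> side" "p1 \<in> side \<longleftrightarrow> p3 \<in> side"
    using assms edge_side by blast+
  consider "k = 0" | "k = 1" | "k = 2" using k(1) by linarith
  then show False
  proof cases
    case 1
    then show False using k assms by simp
  next
    case 2
    then have "{p1, p5} \<in> E" using k by (simp add: adj_rel_induced_iff)
    then show False using sides edge_side by blast
  next
    case 3
    then obtain c where "(p1, c) \<in> ?R" "(c, p5) \<in> ?R"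
      using k by (auto simp: numeral_2_eq_2)
    then have c: "c \<in> ?X" "{p1, c} \<in> E" "{c, p5} \<in> E"
      unfolding adj_rel_induced_iff by blast+
    \<comment> \<open>By sides \<open>c\<close> is \<open>p2\<close> or \<open>p4\<close>, and
      either choice needs an excluded chord.\<close>
    then show False using assms sides edge_side edge_in by blast
  qed
qed

text \<open>Otherwise \<open>y'\<close> has a neighbour \<open>a\<close> on the level of
  \<open>z\<close>, and the vertices up to that level connect \<open>a\<close> to \<open>z\<close>.
  Since \<open>y'\<close>, \<open>x\<close>, \<open>y\<close>, \<open>z\<close> is a walk of length
  3, distance heredity yields a walk from \<open>y'\<close> to \<open>z\<close> of at most this
  length that avoids \<open>x\<close> and \<open>y\<close>. The two walks together contain a
  forbidden induced path on five vertices.\<close>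

lemma siblings_same_parents:
  assumes "{x, y} \<in> E" "{x, y'} \<in> E" "lev x = Suc (lev y)" "lev x = Suc (lev y')"
    and "{y, z} \<in> E" "lev y = Suc (lev z)"
  shows "{y', z} \<in> E"
proof (rule ccontr)
  assume nz: "{y', z} \<notin> E"
  then have "y' \<noteq> y" using assms by auto
  then obtain a where a: "{y', a} \<in> E" "lev y' = Suc (lev a)"
    using lev_parent[of y' y] assms edge_in by auto
  let ?L = "{w \<in> V. lev w \<le> lev z}"
  let ?X = "insert y' ?L"
  let ?R = "adj_rel (induced_edges E ?X)"
  have "(a, z) \<in> (adj_rel (induced_edges E ?L))\<^sup>*"
    using same_level_connected[of a z "lev z"] a assms edge_in by auto
  moreover have "adj_rel (induced_edges E ?L) \<subseteq> ?R"
    by (auto simp: adj_rel_induced_iff)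
  ultimately have "(a, z) \<in> ?R\<^sup>*" using rtrancl_mono by blast
  moreover have "(y', a) \<in> ?R"
    using a assms edge_in by (auto simp: adj_rel_induced_iff)
  ultimately have "(y', z) \<in> ?R\<^sup>*" by (meson converse_rtrancl_into_rtrancl)
  moreover have "(y', z) \<in> adj_rel E ^^ 3"
    using assms edge_sym[OF assms(2)] by (force simp: numeral_3_eq_3 adj_rel_iff relcomp_unfold)
  moreover have "?X \<subseteq> V" using assms edge_in by blast
  ultimately obtain k where k: "k \<le> 3" "(y', z) \<in> ?R ^^ k"
    using distance_hereditary_walk[of V E ?X y' z 3] bdh
    by (auto simp: bipartite_distance_hereditary_def)
  have side: "(y' \<in> side) \<noteq> (z \<in> side)" using assms edge_side by blast
  consider "k = 0" | "k = 1" | "k = 2" | "k = 3" using k(1) by linarith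
  then show False
  proof cases
    case 1
    then show False using k side by simp
  next
    case 2
    then show False using k nz by (simp add: adj_rel_induced_iff)
  next
    case 3
    then obtain c where "(y', c) \<in> ?R" "(c, z) \<in> ?R"
      using k by (auto simp: numeral_2_eq_2)
    then have "{y', c} \<in> E" "{c, z} \<in> E"
      unfolding adj_rel_induced_iff by blast+
    then show False using side edge_side by blast
  next
    case 4
    then obtain c b where "(y', c) \<in> ?R" "(c, b) \<in> ?R" "(b, z) \<in> ?R"
      using k by (auto simp: numeral_3_eq_3)
    then have c: "c \<in> ?X" "b \<in> ?X" "{y', c} \<in> E" "{c, b} \<in> E" "{b, z} \<in> E"
      unfolding adj_rel_induced_iff by blast+
    then have "b \<noteq> y'" using nz by auto
    then have "lev b \<le> lev z" using c by auto
    then have lb: "lev z = Suc (lev b)" using lev_edge[OF c(5)] by auto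
    then have "{x, b} \<notin> E" using assms lev_edge[of x b] by auto
    \<comment> \<open>\<open>b\<close> is one level below \<open>z\<close> and hence not adjacent to
      \<open>x\<close>. So the path \<open>y'\<close>, \<open>x\<close>, \<open>y\<close>,
      \<open>z\<close>, \<open>b\<close> is induced, although \<open>c\<close> is adjacent to both
      of its ends.\<close>
    then show False
      using induced_P5_ends_no_common_neighbour[of y' x y z b c] c(3,4) edge_sym[OF c(5)]
        edge_sym[OF assms(2)] assms(1,5) nz \<open>b \<noteq> y'\<close> by simp
  qed
qed

text \<open>The path \<open>p\<close>, \<open>x\<close>, \<open>y\<close>, \<open>x'\<close>,
  \<open>q\<close> is induced. A parent \<open>z\<close> of \<open>y\<close> is by
  \<open>siblings_same_parents\<close> also adjacent to \<open>p\<close> and \<open>q\<close>, a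
  forbidden common neighbour of the ends.\<close>

lemma down_neighbourhoods_laminar:
  assumes "{x, y} \<in> E" "{x', y} \<in> E" "lev x = Suc (lev y)" "lev x' = Suc (lev y)"
    and "{x, p} \<in> E" "{x', p} \<notin> E" "lev x = Suc (lev p)"
    and "{x', q} \<in> E" "{x, q} \<notin> E" "lev x' = Suc (lev q)"
  shows False
proof -
  \<comment> \<open>\<open>lev_parent\<close> asks for a second vertex on the level of
    \<open>y\<close>; \<open>p\<close> serves as one.\<close>
  have "y \<noteq> p" using assms by auto
  then obtain z where z: "{y, z} \<in> E" "lev y = Suc (lev z)"
    using lev_parent[of y p] assms edge_in by auto
  have "{p, z} \<in> E" using siblings_same_parents[of x y p z] assms z by auto
  moreover have "{q, z} \<in> E" using siblings_same_parents[of x' y q z] assms z by auto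
  ultimately show False
    using induced_P5_ends_no_common_neighbour[of p x y x' q z] assms edge_sym by blast
qed

text \<open>All neighbours of \<open>x\<close> in \<open>W\<close> lie one level lower. A neighbour
  \<open>z\<close> of one of them is either a further level lower, where siblings share their
  parents, or on the level of \<open>x\<close>, where laminarity and the minimal degree of
  \<open>x\<close> make it adjacent to all of them. Exchanging \<open>y\<close> and
  \<open>y'\<close> gives equality.\<close>

lemma extremal_neighbours_twins:
  assumes W: "W \<subseteq> V" and x: "x \<in> W"
    and top: "\<And>v. v \<in> W \<Longrightarrow> nbhd E v \<inter> W \<noteq> {} \<Longrightarrow> lev v \<le> lev x"
    and least: "\<And>v. v \<in> W \<Longrightarrow> nbhd E v \<inter> W \<noteq> {} \<Longrightarrow> lev v = lev x \<Longrightarrow>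
        card (nbhd E x \<inter> W) \<le> card (nbhd E v \<inter> W)"
    and y: "y \<in> nbhd E x \<inter> W" and y': "y' \<in> nbhd E x \<inter> W"
  shows "nbhd E y \<inter> W \<subseteq> nbhd E y' \<inter> W"
proof
  fix z assume z: "z \<in> nbhd E y \<inter> W"
  have down: "lev v = Suc (lev w)" if "{v, w} \<in> E" "v \<in> W" "w \<in> W" "lev v = lev x" for v w
  proof -
    have "v \<in> nbhd E w \<inter> W" using that by (simp add: nbhd_def insert_commute)
    then have "lev w \<le> lev v" using top[of w] that by auto
    then show ?thesis using lev_edge[of v w] that by auto
  qed
  have xy: "{x, y} \<in> E" "{x, y'} \<in> E" "{y, z} \<in> E" "y \<in> W" "y' \<in> W" "z \<in> W"
    using y y' z by (auto simp: nbhd_def)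
  have lx: "lev x = Suc (lev y)" "lev x = Suc (lev y')" using down x xy by auto
  have "{y', z} \<in> E"
  proof (cases "lev y = Suc (lev z)")
    case True
    then show ?thesis using siblings_same_parents xy lx by blast
  next
    case False
    then have lz: "lev z = lev x" using lev_edge[of y z] xy lx by auto
    show ?thesis
    proof (rule ccontr)
      assume ny: "{y', z} \<notin> E"
      \<comment> \<open>A vertex \<open>q\<close> adjacent to \<open>z\<close> but not to
        \<open>x\<close>, together with \<open>y'\<close>, adjacent to \<open>x\<close> but not to
        \<open>z\<close>, would contradict laminarity.\<close>
      have sub: "nbhd E z \<inter> W \<subseteq> nbhd E x \<inter> W"
      proof
        fix q assume q: "q \<in> nbhd E z \<inter> W"
        then show "q \<in> nbhd E x \<inter> W"
          using down_neighbourhoods_laminar[of x y z y' q] down[of z q] lz lx xy ny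
          by (auto simp: nbhd_def insert_commute)
      qed
      moreover have "y' \<notin> nbhd E z" using ny by (simp add: nbhd_def insert_commute)
      ultimately have "nbhd E z \<inter> W \<subset> nbhd E x \<inter> W" using y' by blast
      moreover have "finite W" using W simple finite_subset by (auto simp: simple_graph_def)
      ultimately have "card (nbhd E z \<inter> W) < card (nbhd E x \<inter> W)"
        by (simp add: psubset_card_mono)
      moreover have "y \<in> nbhd E z \<inter> W" using xy by (simp add: nbhd_def insert_commute)
      ultimately show False using least[of z] xy lz by auto
    qed
  qed
  then show "z \<in> nbhd E y' \<inter> W" using xy by (simp add: nbhd_def)
qed

end

section \<open>Legal sequences in induced subgraphs\<close>

text \<open>In \<open>legal_from E W C vs\<close> the set \<open>C\<close> collects the vertices dominated before \<open>vs\<close> starts.\<close>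

primrec legal_from :: "'a set set \<Rightarrow> 'a set \<Rightarrow> 'a set \<Rightarrow> 'a list \<Rightarrow> bool" where
  "legal_from E W C [] \<longleftrightarrow> True"
| "legal_from E W C (v # vs) \<longleftrightarrow>
     v \<in> W \<and> nbhd E v \<inter> W - C \<noteq> {} \<and> legal_from E W (C \<union> nbhd E v) vs"

lemma legal_from_append:
  "legal_from E W C (xs @ ys) \<longleftrightarrow>
    legal_from E W C xs \<and> legal_from E W (C \<union> (\<Union>v\<in>set xs. nbhd E v)) ys"
  by (induction xs arbitrary: C) (auto simp: Un_assoc)

text \<open>Only domination of vertices of \<open>W'\<close> matters for legality in
  \<open>W'\<close>, so shrinking the graph or enlarging the set of dominated vertices makes
  legality harder.\<close>

lemma legal_from_mono:
  "legal_from E W' C' vs \<Longrightarrow> W' \<subseteq> W \<Longrightarrow> C \<inter> W' \<subseteq> C' \<Longrightarrow> legal_from E W C vs"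
proof (induction vs arbitrary: C C')
  case (Cons v vs)
  then show ?case by (auto intro!: Cons.IH[of "C' \<union> nbhd E v"])
qed simp

lemma legal_from_set: "legal_from E W C vs \<Longrightarrow> set vs \<subseteq> W"
  by (induction vs arbitrary: C) auto

text \<open>A repeated vertex would have no newly dominated neighbour, which is how
  \<open>legal_from\<close> ensures distinctness.\<close>

lemma legal_seq_iff_legal_from:
  assumes "simple_graph V E"
  shows "legal_seq V E vs \<longleftrightarrow> legal_from E V {} vs"
proof -
  have nb: "nbhd E v \<subseteq> V" for v
    using assms by (auto simp: simple_graph_def nbhd_def)
  show ?thesis
  proof (induction vs rule: rev_induct)
    case (snoc v vs)
    have un: "(\<Union>j<length vs. nbhd E (vs ! j)) = (\<Union>w\<in>set vs. nbhd E w)"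
      by (force simp: in_set_conv_nth)
    have "legal_seq V E (vs @ [v]) \<longleftrightarrow>
        legal_seq V E vs \<and> v \<in> V \<and> nbhd E v - (\<Union>w\<in>set vs. nbhd E w) \<noteq> {}"
      unfolding legal_seq_def un[symmetric]
      by (auto simp: less_Suc_eq nth_append all_conj_distrib un)
    then show ?case using snoc nb[of v] by (auto simp: legal_from_append)
  qed (simp add: legal_seq_def)
qed

section \<open>Removing a vertex whose neighbours are pairwise twins\<close>

locale twin_neighbours =
  fixes V :: "'a set" and E :: "'a set set" and W :: "'a set" and x u :: 'a
  assumes simple: "simple_graph V E" and x: "x \<in> W" and u: "u \<in> nbhd E x \<inter> W"
    and twins: "\<And>y y'. y \<in> nbhd E x \<inter> W \<Longrightarrow> y' \<in> nbhd E x \<inter> W \<Longrightarrow> nbhd E y \<inter> W \<subseteq> nbhd E y' \<inter> W"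
begin

definition rest :: "'a set" where
  "rest = W - insert x (nbhd E x)"

lemma nbhd_sym: "v \<in> nbhd E w \<longleftrightarrow> w \<in> nbhd E v"
  by (simp add: nbhd_def insert_commute)

lemma nbhd_irrefl: "v \<notin> nbhd E v"
  using simple by (auto simp: nbhd_def simple_graph_def)

text \<open>What \<open>x\<close> dominates lies outside \<open>rest\<close>, so \<open>vs\<close>
  stays legal after it. No vertex of \<open>rest\<close> is adjacent to \<open>x\<close>, so
  \<open>x\<close> itself is still left for \<open>u\<close> to dominate.\<close>

lemma legal_from_extend:
  assumes "legal_from E rest {} vs"
  shows "legal_from E W {} (x # vs @ [u])"
proof -
  have "legal_from E W (nbhd E x) vs"
    using assms by (rule legal_from_mono) (auto simp: rest_def)
  moreover have "x \<notin> nbhd E v" if "v \<in> set vs" for v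
    using that legal_from_set[OF assms] by (auto simp: rest_def nbhd_sym[of x])
  then have "x \<in> nbhd E u \<inter> W - (nbhd E x \<union> (\<Union>v\<in>set vs. nbhd E v))"
    using x u nbhd_irrefl nbhd_sym by auto
  ultimately show ?thesis
    using x u by (auto simp: legal_from_append)
qed

text \<open>Only two vertices have to be dropped: the twins of \<open>u\<close> occur at most once in a legal
  sequence, and all of them are dominated for the first time by one and the same vertex.\<close>

lemma legal_from_reduce_aux:
  "\<lbrakk>legal_from E W C vs; nbhd E x \<inter> W \<subseteq> C \<or> nbhd E x \<inter> W \<inter> C = {};
    x \<in> C \<Longrightarrow> nbhd E u \<inter> W \<subseteq> C\<rbrakk> \<Longrightarrow>
   \<exists>vs'. legal_from E rest C vs' \<and> length vs \<le> length vs' +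
     (if nbhd E x \<inter> W \<subseteq> C then 0 else 1) + (if nbhd E u \<inter> W \<subseteq> C then 0 else 1)"
proof (induction vs arbitrary: C)
  case Nil
  show ?case by (rule exI[of _ "[]"]) simp
next
  case (Cons v vs)
  let ?U = "nbhd E x \<inter> W"
  let ?C = "C \<union> nbhd E v"
  have v: "v \<in> W" "nbhd E v \<inter> W - C \<noteq> {}" and leg: "legal_from E W ?C vs"
    using Cons.prems by auto
  have same: "nbhd E y \<inter> W = nbhd E u \<inter> W" if "y \<in> ?U" for y
    using twins u that by blast
  have weaken: "legal_from E rest C vs'" if "legal_from E rest ?C vs'" for vs'
    using that by (rule legal_from_mono) auto
  consider (twin) "v \<in> ?U" | (dom) "v \<notin> ?U" "nbhd E v \<inter> ?U \<noteq> {}" "\<not> ?U \<subseteq> C"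
    | (keep) "v \<notin> ?U" "nbhd E v \<inter> ?U = {} \<or> ?U \<subseteq> C"
    by blast
  then show ?case
  proof cases
    \<comment> \<open>\<open>v\<close> has the same neighbours in \<open>W\<close> as
      \<open>u\<close>. It is dropped and charged to the last summand, which turns from 1 to
      0.\<close>
    case twin
    have "?U \<inter> nbhd E v = {}"
      using same twin nbhd_irrefl by blast
    then have U: "?U \<subseteq> ?C \<longleftrightarrow> ?U \<subseteq> C" "?U \<inter> ?C = ?U \<inter> C" by auto
    have "\<not> nbhd E u \<inter> W \<subseteq> C" "nbhd E u \<inter> W \<subseteq> ?C" using v same[OF twin] by auto
    with Cons.IH[OF leg] U Cons.prems(2) obtain vs' where
      "legal_from E rest ?C vs'" "length vs \<le> length vs' + (if ?U \<subseteq> C then 0 else 1)"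
      by auto
    then show ?thesis using weaken \<open>\<not> nbhd E u \<inter> W \<subseteq> C\<close> by (intro exI[of _ vs']) auto
  next
    \<comment> \<open>\<open>v\<close> is adjacent to one and hence to all of the twins. It is
      dropped and charged to the first of the two conditional summands.\<close>
    case dom
    then have U: "?U \<subseteq> ?C" using same nbhd_sym v(1) by blast
    have "x \<in> ?C \<Longrightarrow> x \<in> C" using dom v nbhd_sym by blast
    then have "x \<in> ?C \<Longrightarrow> nbhd E u \<inter> W \<subseteq> ?C" using Cons.prems(3) by auto
    with Cons.IH[OF leg] U obtain vs' where
      "legal_from E rest ?C vs'" "length vs \<le> length vs' + (if nbhd E u \<inter> W \<subseteq> ?C then 0 else 1)"
      by auto
    then show ?thesis using weaken dom(3) by (intro exI[of _ vs']) (auto split: if_splits)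
  next
    \<comment> \<open>\<open>v\<close> stays: it lies in \<open>rest\<close>, and what it newly
      dominates in \<open>W\<close> is neither \<open>x\<close> nor a neighbour of
      \<open>x\<close>.\<close>
    case keep
    have nx: "x \<notin> nbhd E v" using keep(1) v nbhd_sym by blast
    have "v \<noteq> x" using keep v u by auto
    then have "v \<in> rest" using v keep by (auto simp: rest_def)
    moreover have "nbhd E v \<inter> rest - C \<noteq> {}" using v keep nx by (auto simp: rest_def)
    moreover have "?U \<subseteq> ?C \<or> ?U \<inter> ?C = {}" using keep Cons.prems(2) by blast
    moreover have "x \<in> ?C \<Longrightarrow> nbhd E u \<inter> W \<subseteq> ?C" using Cons.prems(3) nx by auto
    moreover note Cons.IH[OF leg]
    ultimately obtain vs' where vs': "legal_from E rest C (v # vs')"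
      "length vs \<le> length vs' + (if ?U \<subseteq> ?C then 0 else 1) + (if nbhd E u \<inter> W \<subseteq> ?C then 0 else 1)"
      by auto
    have "?U \<subseteq> C \<Longrightarrow> ?U \<subseteq> ?C" "nbhd E u \<inter> W \<subseteq> C \<Longrightarrow> nbhd E u \<inter> W \<subseteq> ?C" by auto
    then show ?thesis using vs' by (intro exI[of _ "v # vs'"]) (auto split: if_splits)
  qed
qed

lemma legal_from_reduce:
  assumes "legal_from E W {} vs"
  obtains vs' where "legal_from E rest {} vs'" "length vs \<le> length vs' + 2"
proof -
  obtain vs' where "legal_from E rest {} vs'" "length vs \<le> length vs' +
      (if nbhd E x \<inter> W \<subseteq> {} then 0 else 1) + (if nbhd E u \<inter> W \<subseteq> {} then 0 else 1)"
    using legal_from_reduce_aux[OF assms] by auto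
  then show thesis using that[of vs'] by (simp split: if_splits)
qed

end

section \<open>Total correctness with running time\<close>

definition wp :: "com \<Rightarrow> nat \<Rightarrow> (state \<Rightarrow> bool) \<Rightarrow> state \<Rightarrow> bool" where
  "wp c B Q s \<longleftrightarrow> (\<exists>T t. exec c s T t \<and> T \<le> B \<and> Q t)"

lemma wp_mono: "wp c B Q s \<Longrightarrow> B \<le> B' \<Longrightarrow> (\<And>t. Q t \<Longrightarrow> Q' t) \<Longrightarrow> wp c B' Q' s"
  unfolding wp_def by (meson le_trans)

lemma wp_Seq: "wp c B (wp d B' Q) s \<Longrightarrow> wp (Seq c d) (B + B') Q s"
  unfolding wp_def by (meson add_mono exec.Seq)

lemma wp_Cond:
  assumes "eval_test b s \<Longrightarrow> wp c B Q s" "\<not> eval_test b s \<Longrightarrow> wp d B Q s"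
  shows "wp (Cond b c d) (1 + cost_test b + B) Q s"
  using assms unfolding wp_def by (meson add_left_mono exec.CondFalse exec.CondTrue)

section \<open>Symbolic execution of loop-free programs\<close>

primrec loop_free :: "com \<Rightarrow> bool" where
  "loop_free Skip \<longleftrightarrow> True"
| "loop_free (Assign x e) \<longleftrightarrow> True"
| "loop_free (Store a e f) \<longleftrightarrow> True"
| "loop_free (Seq c d) \<longleftrightarrow> loop_free c \<and> loop_free d"
| "loop_free (Cond b c d) \<longleftrightarrow> loop_free c \<and> loop_free d"
| "loop_free (While b c) \<longleftrightarrow> False"

primrec run :: "com \<Rightarrow> state \<Rightarrow> state" where
  "run Skip s = s"
| "run (Assign x e) s = s\<lparr>vars := (vars s)(x := eval_exp e s)\<rparr>"
| "run (Store a e f) s = s\<lparr>arrs := (arrs s)(a := (arrs s a)(eval_exp e s := eval_exp f s))\<rparr>"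
| "run (Seq c d) s = run d (run c s)"
| "run (Cond b c d) s = (if eval_test b s then run c s else run d s)"
| "run (While b c) s = undefined"

primrec max_cost :: "com \<Rightarrow> nat" where
  "max_cost Skip = 1"
| "max_cost (Assign x e) = 1 + cost_exp e"
| "max_cost (Store a e f) = 1 + cost_exp e + cost_exp f"
| "max_cost (Seq c d) = max_cost c + max_cost d"
| "max_cost (Cond b c d) = 1 + cost_test b + max (max_cost c) (max_cost d)"
| "max_cost (While b c) = undefined"

text \<open>\<open>max_cost\<close> charges the dearer branch of every conditional, so it bounds the
  time of whichever path \<open>run\<close> takes.\<close>

lemma wp_loop_free: "loop_free c \<Longrightarrow> max_cost c \<le> B \<Longrightarrow> Q (run c s) \<Longrightarrow> wp c B Q s"
proof (induction c arbitrary: s B Q)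
  case Skip
  then show ?case unfolding wp_def using exec.Skip by fastforce
next
  case (Assign x e)
  then show ?case unfolding wp_def using exec.Assign by fastforce
next
  case (Store a e f)
  then show ?case unfolding wp_def using exec.Store by fastforce
next
  case (Seq c d)
  have "wp c (max_cost c) (wp d (max_cost d) Q) s"
    by (rule Seq.IH(1)) (use Seq in auto)
  then show ?case using wp_mono[OF wp_Seq] Seq.prems by fastforce
next
  case (Cond b c d)
  have "wp (Cond b c d) (1 + cost_test b + max (max_cost c) (max_cost d)) Q s"
    by (rule wp_Cond; rule Cond.IH; use Cond.prems in simp)
  then show ?case using wp_mono Cond.prems by fastforce
next
  case (While b c)
  then show ?case by simp
qed

section \<open>Counted loops and their cost\<close>

definition For :: "name \<Rightarrow> exp \<Rightarrow> exp \<Rightarrow> com \<Rightarrow> com" where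
  "For x lo hi c =
     Seq (Assign x lo) (While (Less (Var x) hi) (Seq c (Assign x (Succ (Var x)))))"

abbreviation set_var :: "name \<Rightarrow> nat \<Rightarrow> state \<Rightarrow> state" where
  "set_var x k s \<equiv> s\<lparr>vars := (vars s)(x := k)\<rparr>"

text \<open>A round pays at most 6 for the test and 3 for the increment, and the failing test at the
  end at most 6. Since \<open>hi\<close> is evaluated anew in every round, the invariant has to fix
  its value.\<close>

lemma wp_While_upto:
  assumes hi: "\<And>k t. I k t \<Longrightarrow> vars t x = k \<and> eval_exp hi t = h"
    and cost: "cost_exp hi \<le> 3"
    and body: "\<And>k t. l \<le> k \<Longrightarrow> k < h \<Longrightarrow> I k t \<Longrightarrow>
      wp c (b k) (\<lambda>t. vars t x = k \<and> I (Suc k) (set_var x (Suc k) t)) t"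
  shows "l \<le> k \<Longrightarrow> k \<le> h \<Longrightarrow> I k s \<Longrightarrow>
    wp (While (Less (Var x) hi) (Seq c (Assign x (Succ (Var x)))))
      (6 + (\<Sum>i=k..<h. b i + 10)) (I h) s"
proof (induction "h - k" arbitrary: k s)
  case 0
  then have "k = h" by simp
  then have "\<not> eval_test (Less (Var x) hi) s" using hi[OF 0(4)] by simp
  from exec.WhileFalse[OF this] show ?case
    unfolding wp_def using 0(4) cost \<open>k = h\<close> by (intro exI conjI) auto
next
  case (Suc m)
  let ?b = "Less (Var x) hi" and ?c = "Seq c (Assign x (Succ (Var x)))"
  have "k < h" using Suc by simp
  then have t: "eval_test ?b s" using hi[OF Suc.prems(3)] by simp
  obtain T1 s1 where 1: "exec c s T1 s1" "T1 \<le> b k" "vars s1 x = k"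
    "I (Suc k) (set_var x (Suc k) s1)"
    using body[OF Suc.prems(1) \<open>k < h\<close> Suc.prems(3)] unfolding wp_def by blast
  have 2: "exec ?c s (T1 + 3) (set_var x (Suc k) s1)"
    using exec.Seq[OF 1(1) exec.Assign[of x "Succ (Var x)" s1]] 1(3) by (simp add: numeral_3_eq_3)
  have "m = h - Suc k" using Suc.hyps(2) by simp
  then obtain T2 t where 3: "exec (While ?b ?c) (set_var x (Suc k) s1) T2 t"
    "T2 \<le> 6 + (\<Sum>i=Suc k..<h. b i + 10)" "I h t"
    using Suc.hyps(1)[OF _ _ _ 1(4)] Suc.prems(1) \<open>k < h\<close>
    unfolding wp_def by auto
  have "exec (While ?b ?c) s (1 + cost_test ?b + (T1 + 3) + T2) t"
    by (rule exec.WhileTrue[OF t 2 3(1)])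
  moreover have "1 + cost_test ?b + (T1 + 3) + T2 \<le> 6 + (\<Sum>i=k..<h. b i + 10)"
    using 1 3 cost \<open>k < h\<close> by (simp add: sum.atLeast_Suc_lessThan)
  ultimately show ?case using 3(3) unfolding wp_def by blast
qed

text \<open>The constant 10 consists of at most 4 for the initial assignment and 6 for the failing
  test.\<close>

lemma wp_For:
  assumes hi: "\<And>k t. I k t \<Longrightarrow> vars t x = k \<and> eval_exp hi t = h"
    and lo: "eval_exp lo s = l" "l \<le> h"
    and cost: "cost_exp lo \<le> 3" "cost_exp hi \<le> 3"
    and init: "I l (set_var x l s)"
    and body: "\<And>k t. l \<le> k \<Longrightarrow> k < h \<Longrightarrow> I k t \<Longrightarrow>
      wp c (b k) (\<lambda>t. vars t x = k \<and> I (Suc k) (set_var x (Suc k) t)) t"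
    and post: "\<And>t. I h t \<Longrightarrow> Q t"
    and B: "10 + (\<Sum>k=l..<h. b k + 10) \<le> B"
  shows "wp (For x lo hi c) B Q s"
proof -
  let ?w = "While (Less (Var x) hi) (Seq c (Assign x (Succ (Var x))))"
  let ?S = "\<Sum>k=l..<h. b k + 10"
  have "wp ?w (6 + ?S) (I h) (set_var x l s)"
    using wp_While_upto[of I x hi h l c b l "set_var x l s"] assms by blast
  then have "wp (Assign x lo) 4 (wp ?w (6 + ?S) (I h)) s"
    using lo cost wp_loop_free[of "Assign x lo"] by simp
  then have "wp (For x lo hi c) (4 + (6 + ?S)) (I h) s"
    unfolding For_def by (rule wp_Seq)
  then show ?thesis by (rule wp_mono) (use B post in auto)
qed

section \<open>The program\<close>

text \<open>If no vertex has level \<open>d\<close>, the search of a component has ended, and an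
  unreached vertex becomes the root of the next one on level \<open>d\<close>. This shifts the
  levels of different components apart.\<close>

definition assign_root :: com where
  "assign_root =
    Seq (Assign ''f'' (Const 0))
    (Seq (For ''v'' (Const 0) (Var ''n'')
      (Cond (Equal (Elem ''lev'' (Var ''v'')) (Var ''d'')) (Assign ''f'' (Const 1)) Skip))
    (For ''v'' (Const 0) (Var ''n'')
      (Cond (Conj (Equal (Var ''f'') (Const 0)) (Equal (Elem ''lev'' (Var ''v'')) (Const 0)))
        (Seq (Store ''lev'' (Var ''v'') (Var ''d'')) (Assign ''f'' (Const 1))) Skip)))"

definition expand_level :: com where
  "expand_level =
    For ''v'' (Const 0) (Var ''n'')
      (Cond (Equal (Elem ''lev'' (Var ''v'')) (Var ''d''))
        (For ''j'' (Elem ''off'' (Var ''v'')) (Elem ''off'' (Succ (Var ''v'')))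
          (Cond (Equal (Elem ''lev'' (Elem ''adj'' (Var ''j''))) (Const 0))
            (Store ''lev'' (Elem ''adj'' (Var ''j'')) (Succ (Var ''d''))) Skip))
        Skip)"

text \<open>The rounds from 1 to \<open>n\<close> suffice because every round that leaves a vertex
  unreached has a nonempty level of its own.\<close>

definition compute_levels :: com where
  "compute_levels = For ''d'' (Const 1) (Succ (Var ''n'')) (Seq assign_root expand_level)"

text \<open>Tests have no disjunction, so the negated conjunctions encode a lexicographic
  comparison: larger level first, then smaller degree \<open>c\<close>.\<close>

definition select_vertex :: com where
  "select_vertex =
    Seq (Assign ''bl'' (Const 0))
    (For ''v'' (Const 0) (Var ''n'')
      (Cond (Equal (Elem ''del'' (Var ''v'')) (Const 0))
        (Seq (Assign ''c'' (Const 0))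
        (Seq (For ''j'' (Elem ''off'' (Var ''v'')) (Elem ''off'' (Succ (Var ''v'')))
          (Cond (Equal (Elem ''del'' (Elem ''adj'' (Var ''j''))) (Const 0))
            (Assign ''c'' (Succ (Var ''c''))) Skip))
        (Cond (Conj (Less (Const 0) (Var ''c''))
            (Neg (Conj (Neg (Less (Var ''bl'') (Elem ''lev'' (Var ''v''))))
              (Neg (Conj (Equal (Var ''bl'') (Elem ''lev'' (Var ''v''))) (Less (Var ''c'') (Var ''bc'')))))))
          (Seq (Assign ''b'' (Var ''v''))
          (Seq (Assign ''bl'' (Elem ''lev'' (Var ''v''))) (Assign ''bc'' (Var ''c''))))
          Skip)))
        Skip))"

text \<open>Each remaining neighbour overwrites the entry of \<open>sup\<close>, so the last one
  survives; as the neighbours are twins, any of them will do.\<close>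

definition remove_neighbourhood :: com where
  "remove_neighbourhood =
    Cond (Less (Const 0) (Var ''bl''))
      (Seq (Seq (Store ''seq'' (Var ''len'') (Var ''b'')) (Store ''del'' (Var ''b'') (Const 1)))
      (Seq (For ''j'' (Elem ''off'' (Var ''b'')) (Elem ''off'' (Succ (Var ''b'')))
        (Cond (Equal (Elem ''del'' (Elem ''adj'' (Var ''j''))) (Const 0))
          (Seq (Store ''sup'' (Var ''len'') (Elem ''adj'' (Var ''j'')))
            (Store ''del'' (Elem ''adj'' (Var ''j'')) (Const 1)))
          Skip))
      (Assign ''len'' (Succ (Var ''len'')))))
      Skip"

definition eliminate :: com where
  "eliminate =
    Seq (Assign ''len'' (Const 0))
    (For ''k'' (Const 0) (Var ''n'') (Seq select_vertex remove_neighbourhood))"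

text \<open>Later eliminations are nested inside earlier ones, so their supports come first.
  \<open>m\<close> keeps the number of eliminations while \<open>len\<close> grows.\<close>

definition append_supports :: com where
  "append_supports =
    Seq (Assign ''m'' (Var ''len''))
    (For ''j'' (Const 0) (Var ''m'')
      (Seq (Store ''seq'' (Var ''len'') (Elem ''sup'' (Minus (Var ''m'') (Succ (Var ''j'')))))
        (Assign ''len'' (Succ (Var ''len'')))))"

definition grundy_program :: com where
  "grundy_program = Seq compute_levels (Seq eliminate append_supports)"

section \<open>Correctness of the program\<close>

locale adjacency_lists =
  fixes n :: nat and E :: "nat set set" and off adj :: "nat \<Rightarrow> nat"
  assumes simple: "simple_graph {..<n} E"
    and off_0: "off 0 = 0"
    and off_mono: "v < n \<Longrightarrow> off v \<le> off (Suc v)"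
    and adj_bij: "v < n \<Longrightarrow> bij_betw adj {off v..<off (Suc v)} (nbhd E v)"
begin

section \<open>Adjacency lists and the number of edges\<close>

lemma nbhd_subset: "nbhd E v \<subseteq> {..<n}"
  using simple by (auto simp: simple_graph_def nbhd_def)

lemma adj_image: "v < n \<Longrightarrow> adj ` {off v..<off (Suc v)} = nbhd E v"
  using adj_bij by (simp add: bij_betw_def)

lemma sum_off: "k \<le> n \<Longrightarrow> (\<Sum>v<k. off (Suc v) - off v) = off k"
proof (induction k)
  case (Suc k)
  then show ?case using off_mono[of k] by simp
qed (simp add: off_0)

lemma sum_off': "(\<Sum>v=0..<n. a + c * (off (Suc v) - off v)) = a * n + c * off n"
proof -
  have "(\<Sum>v<n. c * (off (Suc v) - off v)) = c * off n"
    using sum_off[of n] by (simp flip: sum_distrib_left)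
  then show ?thesis by (simp add: sum.distrib atLeast0LessThan)
qed

lemma off_diff_le: "v < n \<Longrightarrow> off (Suc v) - off v \<le> off n"
proof -
  assume "v < n"
  then have "off (Suc v) - off v \<le> (\<Sum>v<n. off (Suc v) - off v)"
    by (intro member_le_sum) auto
  then show ?thesis using sum_off by simp
qed

text \<open>\<open>off n\<close> counts the ordered pairs of adjacent vertices, and every edge
  provides at most two of them.\<close>

lemma off_le_card_edges: "off n \<le> 2 * card E"
proof -
  have fE: "finite E" using simple
    by (auto simp: simple_graph_def intro: finite_subset[of E "Pow {..<n}"])
  have "off n = (\<Sum>v<n. card (nbhd E v))"
  proof -
    have "(\<Sum>v<n. card (nbhd E v)) = (\<Sum>v<n. off (Suc v) - off v)"
      by (rule sum.cong) (use bij_betw_same_card[OF adj_bij] in auto)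
    then show ?thesis using sum_off by simp
  qed
  also have "\<dots> = card (Sigma {..<n} (nbhd E))"
    using finite_subset[OF nbhd_subset] by simp
  also have "Sigma {..<n} (nbhd E) \<subseteq> (\<Union>e\<in>E. {(u, v). e = {u, v}})"
    by (auto simp: nbhd_def)
  moreover have small: "finite {(u, v). e = {u, v}} \<and> card {(u, v). e = {u, v}} \<le> 2" if "e \<in> E" for e
  proof -
    have "card e = 2" using simple that by (simp add: simple_graph_def)
    then obtain a b where "e = {a, b}" by (auto simp: card_2_iff)
    then have sub: "{(u, v). e = {u, v}} \<subseteq> {(a, b), (b, a)}" by (auto simp: doubleton_eq_iff)
    have "card {(u, v). e = {u, v}} \<le> card {(a, b), (b, a)}"
      by (rule card_mono[OF _ sub]) simp
    also have "\<dots> \<le> 2" using card_length[of "[(a, b), (b, a)]"] by simp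
    finally show ?thesis using finite_subset[OF sub] by simp
  qed
  ultimately have "off n \<le> card (\<Union>e\<in>E. {(u, v). e = {u, v}})"
    using fE by (simp add: card_mono)
  also have "\<dots> \<le> (\<Sum>e\<in>E. card {(u, v). e = {u, v}})" by (rule card_UN_le[OF fE])
  also have "\<dots> \<le> (\<Sum>e\<in>E. 2)" by (rule sum_mono) (use small in blast)
  finally show ?thesis by simp
qed

definition holds_input :: "state \<Rightarrow> bool" where
  "holds_input s \<longleftrightarrow> vars s ''n'' = n \<and> arrs s ''off'' = off \<and> arrs s ''adj'' = adj"

subsection \<open>Levels\<close>

definition level_state :: "nat \<Rightarrow> (nat \<Rightarrow> nat) \<Rightarrow> state \<Rightarrow> bool" where
  "level_state d L s \<longleftrightarrow> holds_input s \<and> vars s ''d'' = d \<and> arrs s ''lev'' = L \<and>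
     arrs s ''del'' = (\<lambda>_. 0)"

text \<open>Level \<open>0\<close> marks the vertices that have not been reached, and the levels below \<open>d\<close> have been
  expanded.  The last condition bounds the number of rounds by \<open>n\<close>.\<close>

definition partial_levels :: "nat \<Rightarrow> (nat \<Rightarrow> nat) \<Rightarrow> bool" where
  "partial_levels d L \<longleftrightarrow>
     (\<forall>v<n. L v \<le> d) \<and>
     (\<forall>u v. {u, v} \<in> E \<longrightarrow> 0 < L v \<longrightarrow> L v < d \<longrightarrow> 0 < L u \<and> L u \<le> Suc (L v)) \<and>
     (\<forall>u<n. \<forall>v<n. L u = L v \<longrightarrow> 0 < L u \<longrightarrow> u \<noteq> v \<longrightarrow>
        (\<exists>w. {u, w} \<in> E \<and> 0 < L w \<and> L u = Suc (L w))) \<and>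
     (\<forall>u<n. L u = 0 \<longrightarrow> (\<forall>i. 0 < i \<longrightarrow> i < d \<longrightarrow> (\<exists>v<n. L v = i)))"

text \<open>The cases are: the search of the current component goes on, a new one starts at
  \<open>r\<close>, or no vertex is left.\<close>

definition rooted :: "nat \<Rightarrow> (nat \<Rightarrow> nat) \<Rightarrow> (nat \<Rightarrow> nat) \<Rightarrow> bool" where
  "rooted d L L' \<longleftrightarrow>
     (\<exists>v<n. L v = d) \<and> L' = L \<or>
     (\<forall>v<n. L v \<noteq> d) \<and> (\<exists>r<n. L r = 0 \<and> L' = L(r := d)) \<or>
     (\<forall>v<n. L v \<noteq> 0) \<and> L' = L"

definition expanded :: "nat \<Rightarrow> (nat \<Rightarrow> nat) \<Rightarrow> nat set \<Rightarrow> nat \<Rightarrow> nat" where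
  "expanded d L S = (\<lambda>w. if L w = 0 \<and> w \<in> S then Suc d else L w)"

text \<open>A new root is alone on level \<open>d\<close>, so no parent is demanded of it. Having
  been unreached, it is adjacent to no vertex of a smaller positive level.\<close>

lemma partial_levels_rooted:
  assumes p: "partial_levels d L" and "0 < d" and r: "rooted d L L'"
  shows "partial_levels d L' \<and> ((\<exists>v<n. L' v = d) \<or> (\<forall>v<n. L' v \<noteq> 0))"
proof (cases "L' = L")
  case True
  moreover have "(\<exists>v<n. L' v = d) \<or> (\<forall>v<n. L' v \<noteq> 0)"
    using r unfolding rooted_def by (metis fun_upd_same)
  ultimately show ?thesis using p by simp
next
  case False
  then obtain r where r: "\<forall>v<n. L v \<noteq> d" "r < n" "L r = 0" "L' = L(r := d)"
    using r by (auto simp: rooted_def)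
  have 1: "\<forall>v<n. L' v \<le> d" using p r by (auto simp: partial_levels_def)
  have 2: "\<forall>u v. {u, v} \<in> E \<longrightarrow> 0 < L' v \<longrightarrow> L' v < d \<longrightarrow> 0 < L' u \<and> L' u \<le> Suc (L' v)"
    using p r unfolding partial_levels_def by (metis fun_upd_apply less_irrefl)
  have 3: "\<exists>w. {u, w} \<in> E \<and> 0 < L' w \<and> L' u = Suc (L' w)"
    if uv: "u < n" "v < n" "L' u = L' v" "0 < L' u" "u \<noteq> v" for u v
  proof -
    have "u \<noteq> r" "v \<noteq> r" using uv r by (auto split: if_splits)
    then obtain w where "{u, w} \<in> E" "0 < L w" "L u = Suc (L w)"
      using p uv r unfolding partial_levels_def by (metis fun_upd_apply)
    then show ?thesis using r \<open>u \<noteq> r\<close> by (intro exI[of _ w]) auto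
  qed
  have 4: "\<exists>v<n. L' v = i" if "u < n" "L' u = 0" "0 < i" "i < d" for u i
  proof -
    have "\<exists>v<n. L v = i" using that p r \<open>0 < d\<close> unfolding partial_levels_def
      by (metis fun_upd_apply)
    then show ?thesis using r \<open>0 < i\<close> by (metis fun_upd_other less_irrefl)
  qed
  have "partial_levels d L'" using 1 2 3 4 unfolding partial_levels_def by blast
  then show ?thesis using r by auto
qed

text \<open>Only unreached vertices change, to level \<open>Suc d\<close>, and each gets a parent on
  level \<open>d\<close>. If some vertex stays unreached, \<open>nonempty\<close> makes level
  \<open>d\<close> occupied, which extends the last condition of
  \<open>partial_levels\<close>.\<close>

lemma partial_levels_expanded:
  assumes p: "partial_levels d L" and d: "0 < d" and nonempty: "(\<exists>v<n. L v = d) \<or> (\<forall>v<n. L v \<noteq> 0)"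
  defines "L' \<equiv> expanded d L (\<Union>v\<in>{v. v < n \<and> L v = d}. nbhd E v)"
  shows "partial_levels (Suc d) L'"
proof -
  have le: "L v \<le> d" if "v < n" for v using p that by (simp add: partial_levels_def)
  have vn: "u < n \<and> v < n" if "{u, v} \<in> E" for u v
    using that nbhd_subset[of u] nbhd_subset[of v] by (auto simp: nbhd_def insert_commute)
  have old: "L' v = L v" if "L' v \<le> d \<or> 0 < L v" for v
    using that by (auto simp: L'_def expanded_def split: if_splits)
  have 1: "\<forall>v<n. L' v \<le> Suc d" using le by (auto simp: L'_def expanded_def le_SucI)
  have 2: "0 < L' u \<and> L' u \<le> Suc (L' v)" if e: "{u, v} \<in> E" and v: "0 < L' v" "L' v < Suc d" for u v
  proof -
    have Lv: "L' v = L v" using old[of v] v by simp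
    show ?thesis
    proof (cases "L v < d")
      case True
      then have "0 < L u \<and> L u \<le> Suc (L v)" using p e v Lv by (simp add: partial_levels_def)
      then show ?thesis using old[of u] Lv by simp
    next
      case False
      then have "L v = d" using v Lv by simp
      moreover have "u \<in> nbhd E v" using e by (simp add: nbhd_def insert_commute)
      ultimately have "u \<in> (\<Union>v\<in>{v. v < n \<and> L v = d}. nbhd E v)"
        using vn[OF e] by blast
      then have "0 < L' u" by (auto simp: L'_def expanded_def)
      then show ?thesis using 1 vn[OF e] \<open>L v = d\<close> Lv by auto
    qed
  qed
  have 3: "\<exists>w. {u, w} \<in> E \<and> 0 < L' w \<and> L' u = Suc (L' w)"
    if uv: "u < n" "v < n" "L' u = L' v" "0 < L' u" "u \<noteq> v" for u v
  proof (cases "L' u \<le> d")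
    case True
    then have "L u = L v" "0 < L u" using old[of u] old[of v] uv by simp_all
    then obtain w where "{u, w} \<in> E" "0 < L w" "L u = Suc (L w)"
      using p uv unfolding partial_levels_def by blast
    moreover from this have "L' w = L w" "L' u = L u" using old[of w] old[of u] by simp_all
    ultimately show ?thesis by (intro exI[of _ w]) simp
  next
    case False
    then obtain w where "w < n" "L w = d" "u \<in> nbhd E w"
      using le[OF uv(1)] by (auto simp: L'_def expanded_def split: if_splits)
    moreover from this have "L' w = d" using old[of w] d by simp
    moreover have "L' u = Suc d" using False 1 uv by (metis le_SucE)
    ultimately show ?thesis using d by (intro exI[of _ w]) (auto simp: nbhd_def insert_commute)
  qed
  have 4: "\<exists>v<n. L' v = i" if u: "u < n" "L' u = 0" and i: "0 < i" "i < Suc d" for u i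
  proof -
    have "L u = 0" using u old[of u] by simp
    then have "\<exists>v<n. L v = i"
      using p u i nonempty unfolding partial_levels_def by (metis less_antisym)
    then obtain v where "v < n" "L v = i" by blast
    then show ?thesis using old[of v] i by (intro exI[of _ v]) simp
  qed
  show ?thesis using 1 2 3 4 unfolding partial_levels_def by blast
qed

text \<open>An unreached vertex would leave only \<open>n - 1\<close> vertices to occupy the
  \<open>n\<close> levels from 1 to \<open>n\<close>.\<close>

lemma partial_levels_complete:
  assumes p: "partial_levels (Suc n) L" and v: "v < n"
  shows "0 < L v"
proof (rule ccontr)
  assume "\<not> 0 < L v"
  then have v0: "L v = 0" by simp
  have "{1..n} \<subseteq> L ` ({..<n} - {v})"
  proof
    fix i assume i: "i \<in> {1..n}"
    then obtain w where "w < n" "L w = i"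
      using p v v0 unfolding partial_levels_def by (metis atLeastAtMost_iff le_imp_less_Suc less_le_trans zero_less_one)
    then show "i \<in> L ` ({..<n} - {v})" using i v0 by (intro image_eqI[of _ _ w]) auto
  qed
  then have "card {1..n} \<le> card ({..<n} - {v})"
    by (meson card_image_le card_mono finite_Diff finite_imageI finite_lessThan le_trans)
  then show False using v by simp
qed

text \<open>The edge condition of \<open>partial_levels\<close> covers the levels up to
  \<open>n\<close>; for an end on level \<open>Suc n\<close> the bound holds because no level is
  larger.\<close>

lemma partial_levels_levelled_graph:
  assumes p: "partial_levels (Suc n) L" and bdh: "bipartite_distance_hereditary {..<n} E"
  shows "levelled_graph {..<n} E L"
proof
  fix u v assume e: "{u, v} \<in> E"
  then have "v < n" using nbhd_subset[of u] by (auto simp: nbhd_def)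
  then have "0 < L v" "L v \<le> Suc n" using partial_levels_complete[OF p] p by (auto simp: partial_levels_def)
  moreover have "u < n" using e nbhd_subset[of v] by (auto simp: nbhd_def insert_commute)
  then have "L u \<le> Suc n" using p by (auto simp: partial_levels_def)
  moreover have "L v < Suc n \<Longrightarrow> 0 < L v \<Longrightarrow> L u \<le> Suc (L v)"
    using p e by (simp add: partial_levels_def)
  ultimately show "L u \<le> Suc (L v)" by linarith
next
  fix u v assume "u \<in> {..<n}" "v \<in> {..<n}" "L u = L v" "u \<noteq> v"
  then show "\<exists>w. {u, w} \<in> E \<and> L u = Suc (L w)"
    using p partial_levels_complete[OF p] unfolding partial_levels_def by (metis lessThan_iff)
qed (use simple bdh in auto)

lemma assign_root_correct:
  assumes "level_state d L s" "0 < d"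
  shows "wp assign_root (50 * n + 50) (\<lambda>t. \<exists>L'. rooted d L L' \<and> level_state d L' t) s"
proof -
  let ?A = "\<lambda>k t. level_state d L t \<and> vars t ''v'' = k \<and> vars t ''f'' = (if \<exists>v<k. L v = d then 1 else 0)"
  \<comment> \<open>Invariant of the second loop: flag 1 means that level \<open>d\<close> was
    occupied or has just received its root, flag 0 that the first \<open>k\<close> vertices are all
    reached.\<close>
  define R where "R k f L' \<longleftrightarrow>
     f = 1 \<and> ((\<exists>v<n. L v = d) \<and> L' = L \<or>
        (\<forall>v<n. L v \<noteq> d) \<and> (\<exists>r<n. L r = 0 \<and> L' = L(r := d))) \<or>
     f = 0 \<and> L' = L \<and> (\<forall>v<n. L v \<noteq> d) \<and> (\<forall>v<k. L v \<noteq> 0)" for k f :: nat and L'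
  let ?B = "\<lambda>k t. vars t ''v'' = k \<and> (\<exists>L'. level_state d L' t \<and> R k (vars t ''f'') L')"
  have 1: "wp (For ''v'' (Const 0) (Var ''n'')
      (Cond (Equal (Elem ''lev'' (Var ''v'')) (Var ''d'')) (Assign ''f'' (Const 1)) Skip))
      (20 * n + 10) (?A n) t" if "level_state d L t" "vars t ''f'' = 0" for t
    by (rule wp_For[where I = ?A and l = 0 and h = n and b = "\<lambda>_. 8"])
      (use that in \<open>auto simp: level_state_def holds_input_def less_Suc_eq intro!: wp_loop_free\<close>)
  have 2: "wp (For ''v'' (Const 0) (Var ''n'')
      (Cond (Conj (Equal (Var ''f'') (Const 0)) (Equal (Elem ''lev'' (Var ''v'')) (Const 0)))
        (Seq (Store ''lev'' (Var ''v'') (Var ''d'')) (Assign ''f'' (Const 1))) Skip))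
      (30 * n + 10) (?B n) t" if t: "?A n t" for t
  proof (rule wp_For[where I = ?B and l = 0 and h = n and b = "\<lambda>_. 20"])
    show "?B 0 (set_var ''v'' 0 t)"
      using t by (simp add: level_state_def holds_input_def R_def)
  next
    fix k t assume k: "k < n" and "?B k t"
    then obtain L' where t: "vars t ''v'' = k" "level_state d L' t" and R: "R k (vars t ''f'') L'" by auto
    show "wp (Cond (Conj (Equal (Var ''f'') (Const 0)) (Equal (Elem ''lev'' (Var ''v'')) (Const 0)))
        (Seq (Store ''lev'' (Var ''v'') (Var ''d'')) (Assign ''f'' (Const 1))) Skip) 20
      (\<lambda>t. vars t ''v'' = k \<and> ?B (Suc k) (set_var ''v'' (Suc k) t)) t"
    proof (cases "vars t ''f'' = 0 \<and> L' k = 0")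
      case True
      then have "R (Suc k) 1 (L'(k := d))" using R k by (auto simp: R_def)
      then show ?thesis using True t
        by (intro wp_loop_free) (simp_all add: level_state_def holds_input_def)
    next
      case False
      then have "R (Suc k) (vars t ''f'') L'" using R k by (auto simp: R_def less_Suc_eq)
      then show ?thesis using False t
        by (intro wp_loop_free) (auto simp add: level_state_def holds_input_def)
    qed
  qed (auto simp: level_state_def holds_input_def)
  have 3: "(\<exists>L'. rooted d L L' \<and> level_state d L' t)" if "?B n t" for t
    using that by (auto simp: rooted_def R_def)
  have "wp assign_root (2 + ((20 * n + 10) + (30 * n + 10))) (?B n) s"
    unfolding assign_root_def
    by (rule wp_Seq, rule wp_loop_free, simp, simp, rule wp_Seq, rule wp_mono[OF 1 order_refl 2])
      (use assms in \<open>simp_all add: level_state_def holds_input_def\<close>)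
  then show ?thesis by (rule wp_mono) (use 3 in auto)
qed

lemma expanded_insert:
  "expanded d L (insert w S) =
    (if expanded d L S w = 0 then (expanded d L S)(w := Suc d) else expanded d L S)"
  by (auto simp: expanded_def fun_eq_iff)

lemma adj_image_Suc: "l \<le> j \<Longrightarrow> adj ` {l..<Suc j} = insert (adj j) (adj ` {l..<j})"
  by (simp add: atLeastLessThanSuc)

lemma expand_vertex_correct:
  assumes s: "level_state d (expanded d L S) s" "vars s ''v'' = v" and v: "v < n"
  shows "wp (For ''j'' (Elem ''off'' (Var ''v'')) (Elem ''off'' (Succ (Var ''v'')))
      (Cond (Equal (Elem ''lev'' (Elem ''adj'' (Var ''j''))) (Const 0))
        (Store ''lev'' (Elem ''adj'' (Var ''j'')) (Succ (Var ''d''))) Skip))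
    (10 + 21 * (off (Suc v) - off v))
    (\<lambda>t. vars t ''v'' = v \<and> level_state d (expanded d L (S \<union> nbhd E v)) t) s"
proof (rule wp_For[where l = "off v" and h = "off (Suc v)" and b = "\<lambda>_. 11" and
      I = "\<lambda>j t. vars t ''j'' = j \<and> vars t ''v'' = v \<and>
        level_state d (expanded d L (S \<union> adj ` {off v..<j})) t"])
  fix j t assume j: "off v \<le> j" and
    "vars t ''j'' = j \<and> vars t ''v'' = v \<and> level_state d (expanded d L (S \<union> adj ` {off v..<j})) t"
  then show "wp (Cond (Equal (Elem ''lev'' (Elem ''adj'' (Var ''j''))) (Const 0))
        (Store ''lev'' (Elem ''adj'' (Var ''j'')) (Succ (Var ''d''))) Skip) 11
      (\<lambda>t. vars t ''j'' = j \<and> vars (set_var ''j'' (Suc j) t) ''j'' = Suc j \<and>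
        vars (set_var ''j'' (Suc j) t) ''v'' = v \<and>
        level_state d (expanded d L (S \<union> adj ` {off v..<Suc j})) (set_var ''j'' (Suc j) t)) t"
    by (intro wp_loop_free)
      (simp_all add: adj_image_Suc expanded_insert level_state_def holds_input_def)
qed (use s v off_mono adj_image in \<open>auto simp: level_state_def holds_input_def\<close>)

lemma expand_level_correct:
  assumes s: "level_state d L s" and d: "0 < d"
  shows "wp expand_level (10 + 25 * n + 21 * off n)
    (level_state d (expanded d L (\<Union>v\<in>{v. v < n \<and> L v = d}. nbhd E v))) s"
proof -
  let ?S = "\<lambda>k. \<Union>v\<in>{v. v < k \<and> L v = d}. nbhd E v"
  show ?thesis
    unfolding expand_level_def
  proof (rule wp_For[where l = 0 and h = n and b = "\<lambda>v. 15 + 21 * (off (Suc v) - off v)" and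
        I = "\<lambda>k t. vars t ''v'' = k \<and> level_state d (expanded d L (?S k)) t"])
    fix k t assume k: "k < n" and t: "vars t ''v'' = k \<and> level_state d (expanded d L (?S k)) t"
    \<comment> \<open>Vertices reached during this round carry \<open>Suc d\<close>, so the changing
      array and \<open>L\<close> agree on who has level \<open>d\<close>.\<close>
    have test: "eval_test (Equal (Elem ''lev'' (Var ''v'')) (Var ''d'')) t \<longleftrightarrow> L k = d"
      using t d by (auto simp: level_state_def expanded_def)
    have S: "?S (Suc k) = (if L k = d then ?S k \<union> nbhd E k else ?S k)"
      by (auto simp: less_Suc_eq)
    have set: "level_state d L' (set_var ''v'' i t) = level_state d L' t" for L' i t
      by (simp add: level_state_def holds_input_def)
    let ?I = "For ''j'' (Elem ''off'' (Var ''v'')) (Elem ''off'' (Succ (Var ''v'')))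
          (Cond (Equal (Elem ''lev'' (Elem ''adj'' (Var ''j''))) (Const 0))
            (Store ''lev'' (Elem ''adj'' (Var ''j'')) (Succ (Var ''d''))) Skip)"
    have "wp (Cond (Equal (Elem ''lev'' (Var ''v'')) (Var ''d'')) ?I Skip)
      (1 + cost_test (Equal (Elem ''lev'' (Var ''v'')) (Var ''d'')) + (10 + 21 * (off (Suc k) - off k)))
      (\<lambda>t. vars t ''v'' = k \<and> level_state d (expanded d L (?S (Suc k))) t) t"
    proof (rule wp_Cond)
      assume "eval_test (Equal (Elem ''lev'' (Var ''v'')) (Var ''d'')) t"
      then have "?S (Suc k) = ?S k \<union> nbhd E k" using test S by simp
      then show "wp ?I (10 + 21 * (off (Suc k) - off k))
          (\<lambda>t. vars t ''v'' = k \<and> level_state d (expanded d L (?S (Suc k))) t) t"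
        using expand_vertex_correct[of d L "?S k" t k] t k by simp
    next
      assume "\<not> eval_test (Equal (Elem ''lev'' (Var ''v'')) (Var ''d'')) t"
      then have "?S (Suc k) = ?S k" using test S by simp
      then show "wp Skip (10 + 21 * (off (Suc k) - off k))
          (\<lambda>t. vars t ''v'' = k \<and> level_state d (expanded d L (?S (Suc k))) t) t"
        using t by (intro wp_loop_free) simp_all
    qed
    then show "wp (Cond (Equal (Elem ''lev'' (Var ''v'')) (Var ''d'')) ?I Skip)
      (15 + 21 * (off (Suc k) - off k))
      (\<lambda>t. vars t ''v'' = k \<and> vars (set_var ''v'' (Suc k) t) ''v'' = Suc k \<and>
        level_state d (expanded d L (?S (Suc k))) (set_var ''v'' (Suc k) t)) t"
      by (rule wp_mono) (simp_all add: set)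
  next
    show "10 + (\<Sum>v = 0..<n. 15 + 21 * (off (Suc v) - off v) + 10) \<le> 10 + 25 * n + 21 * off n"
      using sum_off'[of 25 21] by (simp add: add.commute add.left_commute)
  qed (use s in \<open>simp_all add: level_state_def holds_input_def expanded_def\<close>)
qed

lemma compute_levels_correct:
  assumes "holds_input s" "arrs s ''lev'' = (\<lambda>_. 0)" "arrs s ''del'' = (\<lambda>_. 0)"
  shows "wp compute_levels (10 + n * (75 * n + 21 * off n + 70))
    (\<lambda>t. \<exists>L. partial_levels (Suc n) L \<and> level_state (Suc n) L t) s"
  unfolding compute_levels_def
proof (rule wp_For[where l = 1 and h = "Suc n" and b = "\<lambda>_. (50 * n + 50) + (10 + 25 * n + 21 * off n)" and
      I = "\<lambda>d t. \<exists>L. partial_levels d L \<and> level_state d L t"])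
  show "\<exists>L. partial_levels 1 L \<and> level_state 1 L (set_var ''d'' 1 s)"
    using assms by (intro exI[of _ "\<lambda>_. 0"]) (auto simp: partial_levels_def level_state_def holds_input_def)
next
  fix d t assume d: "1 \<le> d" "\<exists>L. partial_levels d L \<and> level_state d L t"
  then obtain L where L: "partial_levels d L" "level_state d L t" by blast
  have step: "wp expand_level (10 + 25 * n + 21 * off n)
      (\<lambda>t. vars t ''d'' = d \<and> (\<exists>L. partial_levels (Suc d) L \<and> level_state (Suc d) L (set_var ''d'' (Suc d) t))) u"
    if u: "\<exists>L'. rooted d L L' \<and> level_state d L' u" for u
  proof -
    obtain L' where L': "rooted d L L'" "level_state d L' u" using u by blast
    have "partial_levels (Suc d) (expanded d L' (\<Union>v\<in>{v. v < n \<and> L' v = d}. nbhd E v))"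
      using partial_levels_rooted[OF L(1) _ L'(1)] partial_levels_expanded[of d L'] d by auto
    then show ?thesis
      by (intro wp_mono[OF expand_level_correct[OF L'(2)]])
        (use d in \<open>auto simp: level_state_def holds_input_def\<close>)
  qed
  show "wp (Seq assign_root expand_level) ((50 * n + 50) + (10 + 25 * n + 21 * off n))
      (\<lambda>t. vars t ''d'' = d \<and> (\<exists>L. partial_levels (Suc d) L \<and> level_state (Suc d) L (set_var ''d'' (Suc d) t))) t"
    by (rule wp_Seq, rule wp_mono[OF assign_root_correct[OF L(2)] order_refl step]) (use d in auto)
qed (auto simp: level_state_def holds_input_def algebra_simps)

subsection \<open>Elimination\<close>

definition alive :: "(nat \<Rightarrow> nat) \<Rightarrow> nat set" where
  "alive D = {v. v < n \<and> D v = 0}"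

definition elim_state ::
  "nat \<Rightarrow> (nat \<Rightarrow> nat) \<Rightarrow> (nat \<Rightarrow> nat) \<Rightarrow> (nat \<Rightarrow> nat) \<Rightarrow> (nat \<Rightarrow> nat) \<Rightarrow> nat \<Rightarrow> state \<Rightarrow> bool" where
  "elim_state k L D Q P l s \<longleftrightarrow> holds_input s \<and> vars s ''k'' = k \<and> vars s ''len'' = l \<and>
     arrs s ''lev'' = L \<and> arrs s ''del'' = D \<and> arrs s ''seq'' = Q \<and> arrs s ''sup'' = P"

text \<open>Among the non-isolated vertices below \<open>k\<close>, the vertex \<open>b\<close> has the largest level \<open>bl\<close> and,
  on this level, the smallest degree \<open>bc\<close>.  The value \<open>bl = 0\<close> means that there is no such vertex.\<close>

definition best :: "(nat \<Rightarrow> nat) \<Rightarrow> nat set \<Rightarrow> nat \<Rightarrow> nat \<Rightarrow> nat \<Rightarrow> nat \<Rightarrow> bool" where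
  "best L W k b bl bc \<longleftrightarrow>
     (if bl = 0 then \<forall>v\<in>W. v < k \<longrightarrow> nbhd E v \<inter> W = {}
      else b \<in> W \<and> bl = L b \<and> nbhd E b \<inter> W \<noteq> {} \<and> bc = card (nbhd E b \<inter> W) \<and>
        (\<forall>v\<in>W. v < k \<longrightarrow> nbhd E v \<inter> W \<noteq> {} \<longrightarrow>
          L v < bl \<or> L v = bl \<and> bc \<le> card (nbhd E v \<inter> W)))"

section \<open>Selecting an extremal vertex and removing its neighbourhood\<close>

lemma finite_nbhd: "finite (nbhd E v)"
  using nbhd_subset finite_subset by blast

text \<open>Positivity of \<open>L k\<close> keeps the value 0 of \<open>bl\<close> free to mean
  that no vertex was found; any non-isolated \<open>k\<close> then beats it.\<close>

lemma best_Suc: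
  assumes b: "best L W k b bl bc" and k: "0 < L k"
  shows "best L W (Suc k)
    (if k \<in> W \<and> 0 < card (nbhd E k \<inter> W) \<and> (bl < L k \<or> bl = L k \<and> card (nbhd E k \<inter> W) < bc) then k else b)
    (if k \<in> W \<and> 0 < card (nbhd E k \<inter> W) \<and> (bl < L k \<or> bl = L k \<and> card (nbhd E k \<inter> W) < bc) then L k else bl)
    (if k \<in> W \<and> 0 < card (nbhd E k \<inter> W) \<and> (bl < L k \<or> bl = L k \<and> card (nbhd E k \<inter> W) < bc)
      then card (nbhd E k \<inter> W) else bc)"
proof -
  have iso: "0 < card (nbhd E k \<inter> W) \<longleftrightarrow> nbhd E k \<inter> W \<noteq> {}"
    using finite_nbhd[of k] by (simp add: card_gt_0_iff)
  show ?thesis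
  proof (cases "bl = 0")
    case True
    then show ?thesis using b k iso by (auto simp: best_def less_Suc_eq)
  next
    case False
    then show ?thesis using b k iso
      by (cases "k \<in> W \<and> 0 < card (nbhd E k \<inter> W) \<and> (bl < L k \<or> bl = L k \<and> card (nbhd E k \<inter> W) < bc)")
        (fastforce simp: best_def less_Suc_eq)+
  qed
qed

text \<open>The program counts list positions; \<open>adj\<close> is injective on the list of
  \<open>v\<close>, so this is the degree in the remaining graph.\<close>

lemma card_alive_neighbours:
  assumes v: "v < n"
  shows "card {i \<in> {off v..<off (Suc v)}. D (adj i) = 0} = card (nbhd E v \<inter> alive D)"
proof -
  let ?I = "{i \<in> {off v..<off (Suc v)}. D (adj i) = 0}"
  have "nbhd E v \<inter> alive D = {w \<in> adj ` {off v..<off (Suc v)}. D w = 0}"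
    using nbhd_subset[of v] by (auto simp: alive_def adj_image[OF v])
  also have "\<dots> = adj ` ?I" by auto
  finally have "nbhd E v \<inter> alive D = adj ` ?I" .
  moreover have "inj_on adj ?I"
    using adj_bij[OF v] by (auto simp: bij_betw_def intro: inj_on_subset)
  ultimately show ?thesis by (simp add: card_image)
qed

lemma count_correct:
  assumes s: "elim_state r L D Q P l s" "vars s ''v'' = v" "vars s ''c'' = 0" "vars s ''b'' = b"
      "vars s ''bl'' = bl" "vars s ''bc'' = bc"
    and v: "v < n"
  shows "wp (For ''j'' (Elem ''off'' (Var ''v'')) (Elem ''off'' (Succ (Var ''v'')))
      (Cond (Equal (Elem ''del'' (Elem ''adj'' (Var ''j''))) (Const 0))
        (Assign ''c'' (Succ (Var ''c''))) Skip))
    (10 + 19 * (off (Suc v) - off v))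
    (\<lambda>t. elim_state r L D Q P l t \<and> vars t ''v'' = v \<and> vars t ''c'' = card (nbhd E v \<inter> alive D) \<and>
       vars t ''b'' = b \<and> vars t ''bl'' = bl \<and> vars t ''bc'' = bc) s"
proof (rule wp_For[where l = "off v" and h = "off (Suc v)" and b = "\<lambda>_. 9" and
      I = "\<lambda>j t. vars t ''j'' = j \<and> elim_state r L D Q P l t \<and> vars t ''v'' = v \<and>
        vars t ''c'' = card {i \<in> {off v..<j}. D (adj i) = 0} \<and>
        vars t ''b'' = b \<and> vars t ''bl'' = bl \<and> vars t ''bc'' = bc"], goal_cases)
  case (7 j t)
  have eq: "{i \<in> {off v..<Suc j}. D (adj i) = 0} =
      (if D (adj j) = 0 then insert j {i \<in> {off v..<j}. D (adj i) = 0} else {i \<in> {off v..<j}. D (adj i) = 0})"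
    using 7 by (auto simp: less_Suc_eq)
  show ?case unfolding eq using 7
    by (intro wp_loop_free) (simp_all add: elim_state_def holds_input_def)
next
  case 8
  then show ?case using card_alive_neighbours[OF v] by simp
qed (use s v off_mono in \<open>simp_all add: elim_state_def holds_input_def\<close>)

lemma select_vertex_correct:
  assumes s: "elim_state r L D Q P l s" and L: "\<And>v. v < n \<Longrightarrow> 0 < L v"
  shows "wp select_vertex (12 + 60 * n + 19 * off n)
    (\<lambda>t. elim_state r L D Q P l t \<and>
       best L (alive D) n (vars t ''b'') (vars t ''bl'') (vars t ''bc'')) s"
proof -
  let ?I = "\<lambda>k t. vars t ''v'' = k \<and> elim_state r L D Q P l t \<and>
     best L (alive D) k (vars t ''b'') (vars t ''bl'') (vars t ''bc'')"
  let ?count = "For ''j'' (Elem ''off'' (Var ''v'')) (Elem ''off'' (Succ (Var ''v'')))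
          (Cond (Equal (Elem ''del'' (Elem ''adj'' (Var ''j''))) (Const 0))
            (Assign ''c'' (Succ (Var ''c''))) Skip)"
  let ?update = "Cond (Conj (Less (Const 0) (Var ''c''))
            (Neg (Conj (Neg (Less (Var ''bl'') (Elem ''lev'' (Var ''v''))))
              (Neg (Conj (Equal (Var ''bl'') (Elem ''lev'' (Var ''v''))) (Less (Var ''c'') (Var ''bc'')))))))
          (Seq (Assign ''b'' (Var ''v''))
          (Seq (Assign ''bl'' (Elem ''lev'' (Var ''v''))) (Assign ''bc'' (Var ''c''))))
          Skip"
  let ?body = "Cond (Equal (Elem ''del'' (Var ''v'')) (Const 0))
        (Seq (Assign ''c'' (Const 0)) (Seq ?count ?update)) Skip"
  have set: "elim_state r L D Q P l (set_var ''v'' i t) = elim_state r L D Q P l t" for i t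
    by (simp add: elim_state_def holds_input_def)
  have body: "wp ?body (50 + 19 * (off (Suc k) - off k))
      (\<lambda>t. vars t ''v'' = k \<and> ?I (Suc k) (set_var ''v'' (Suc k) t)) t" if k: "k < n" and t: "?I k t" for k t
  proof -
    let ?c = "card (nbhd E k \<inter> alive D)"
    let ?b = "vars t ''b''" and ?bl = "vars t ''bl''" and ?bc = "vars t ''bc''"
    note step = best_Suc[of L "alive D" k ?b ?bl ?bc, OF _ L[OF k]]
    have upd: "wp ?update 32 (\<lambda>t. vars t ''v'' = k \<and> elim_state r L D Q P l t \<and>
         best L (alive D) (Suc k) (vars t ''b'') (vars t ''bl'') (vars t ''bc'')) u"
      if u: "elim_state r L D Q P l u \<and> vars u ''v'' = k \<and> vars u ''c'' = ?c \<and>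
        vars u ''b'' = ?b \<and> vars u ''bl'' = ?bl \<and> vars u ''bc'' = ?bc" and kD: "k \<in> alive D" for u
    proof (cases "0 < ?c \<and> (?bl < L k \<or> ?bl = L k \<and> ?c < ?bc)")
      case True
      then have "best L (alive D) (Suc k) k (L k) ?c" using step t kD by simp
      then show ?thesis using True u
        by (intro wp_loop_free) (simp_all add: elim_state_def holds_input_def)
    next
      case False
      then have "best L (alive D) (Suc k) ?b ?bl ?bc" using step t kD by (simp split: if_splits)
      then show ?thesis using False u
        by (intro wp_loop_free) (auto simp: elim_state_def holds_input_def)
    qed
    have "wp ?body (1 + cost_test (Equal (Elem ''del'' (Var ''v'')) (Const 0)) +
        (2 + (10 + 19 * (off (Suc k) - off k) + 32)))
      (\<lambda>t. vars t ''v'' = k \<and> elim_state r L D Q P l t \<and>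
        best L (alive D) (Suc k) (vars t ''b'') (vars t ''bl'') (vars t ''bc'')) t"
    proof (rule wp_Cond)
      assume "eval_test (Equal (Elem ''del'' (Var ''v'')) (Const 0)) t"
      then have kD: "k \<in> alive D" using t k by (simp add: elim_state_def alive_def)
      show "wp (Seq (Assign ''c'' (Const 0)) (Seq ?count ?update))
          (2 + (10 + 19 * (off (Suc k) - off k) + 32))
          (\<lambda>t. vars t ''v'' = k \<and> elim_state r L D Q P l t \<and>
            best L (alive D) (Suc k) (vars t ''b'') (vars t ''bl'') (vars t ''bc'')) t"
        by (rule wp_Seq, rule wp_loop_free, simp, simp, rule wp_Seq,
            rule wp_mono[OF count_correct order_refl upd])
          (use t k kD in \<open>simp_all add: elim_state_def holds_input_def\<close>)
    next
      assume "\<not> eval_test (Equal (Elem ''del'' (Var ''v'')) (Const 0)) t"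
      then have "k \<notin> alive D" using t k by (simp add: elim_state_def alive_def)
      then have "best L (alive D) (Suc k) ?b ?bl ?bc" using step t by simp
      then show "wp Skip (2 + (10 + 19 * (off (Suc k) - off k) + 32))
          (\<lambda>t. vars t ''v'' = k \<and> elim_state r L D Q P l t \<and>
            best L (alive D) (Suc k) (vars t ''b'') (vars t ''bl'') (vars t ''bc'')) t"
        using t by (intro wp_loop_free) simp_all
    qed
    then show ?thesis by (rule wp_mono) (simp_all add: set)
  qed
  have loop: "wp (For ''v'' (Const 0) (Var ''n'') ?body) (10 + 60 * n + 19 * off n) (?I n) t"
    if t: "elim_state r L D Q P l t" "vars t ''bl'' = 0" for t
  proof (rule wp_For[where I = ?I and l = 0 and h = n and b = "\<lambda>k. 50 + 19 * (off (Suc k) - off k)"])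
    show "10 + (\<Sum>v = 0..<n. 50 + 19 * (off (Suc v) - off v) + 10) \<le> 10 + 60 * n + 19 * off n"
      using sum_off'[of 60 19] by (simp add: add.commute add.left_commute)
  next
    fix k t assume "k < n" "?I k t"
    then show "wp ?body (50 + 19 * (off (Suc k) - off k))
      (\<lambda>t. vars t ''v'' = k \<and> ?I (Suc k) (set_var ''v'' (Suc k) t)) t" by (rule body)
  next
    show "?I 0 (set_var ''v'' 0 t)" using t by (simp add: set best_def)
  qed (simp_all add: elim_state_def holds_input_def)
  have "wp select_vertex (2 + (10 + 60 * n + 19 * off n)) (?I n) s"
    unfolding select_vertex_def
    by (rule wp_Seq, rule wp_loop_free, simp, simp, rule loop) (use s in \<open>simp_all add: elim_state_def holds_input_def\<close>)
  then show ?thesis by (rule wp_mono) simp_all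
qed

lemma remove_neighbourhood_correct:
  assumes s: "elim_state r L D Q P l s" "vars s ''b'' = b" "vars s ''bl'' = bl" and bl: "0 < bl"
    and b: "b \<in> alive D" "nbhd E b \<inter> alive D \<noteq> {}"
  shows "wp remove_neighbourhood (23 + 24 * off n)
    (\<lambda>t. \<exists>D' u. u \<in> nbhd E b \<inter> alive D \<and> alive D' = alive D - insert b (nbhd E b) \<and>
       elim_state r L D' (Q(l := b)) (P(l := u)) (Suc l) t) s"
proof -
  have bn: "b < n" using b by (simp add: alive_def)
  have bb: "b \<notin> nbhd E b" using simple by (auto simp: nbhd_def simple_graph_def)
  let ?body = "Cond (Equal (Elem ''del'' (Elem ''adj'' (Var ''j''))) (Const 0))
          (Seq (Store ''sup'' (Var ''len'') (Elem ''adj'' (Var ''j'')))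
            (Store ''del'' (Elem ''adj'' (Var ''j'')) (Const 1)))
          Skip"
  let ?loop = "For ''j'' (Elem ''off'' (Var ''b'')) (Elem ''off'' (Succ (Var ''b''))) ?body"
  \<comment> \<open>\<open>X\<close> collects the neighbours scanned so far; \<open>p\<close> is
    arbitrary until one of them was alive at the start.\<close>
  define R where "R X D' p \<longleftrightarrow> alive D' = alive D - insert b X \<and>
    (X \<inter> alive D \<noteq> {} \<longrightarrow> p \<in> nbhd E b \<inter> alive D)" for X D' and p :: nat
  let ?I = "\<lambda>j t. vars t ''j'' = j \<and> vars t ''b'' = b \<and>
    (\<exists>D' p. elim_state r L D' (Q(l := b)) (P(l := p)) l t \<and> R (adj ` {off b..<j}) D' p)"
  have body: "wp ?body 14 (\<lambda>t. vars t ''j'' = j \<and> ?I (Suc j) (set_var ''j'' (Suc j) t)) t"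
    if j: "off b \<le> j" "j < off (Suc b)" and t: "?I j t" for j t
  proof -
    let ?X = "adj ` {off b..<j}"
    obtain D' p where D': "elim_state r L D' (Q(l := b)) (P(l := p)) l t" "R ?X D' p"
      using t by blast
    have w: "adj j \<in> nbhd E b" using adj_image[OF bn] j by auto
    then have wn: "adj j < n" "adj j \<noteq> b" using nbhd_subset[of b] bb by auto
    have X: "adj ` {off b..<Suc j} = insert (adj j) ?X" using adj_image_Suc j by simp
    show ?thesis
    proof (cases "D' (adj j) = 0")
      case True
      have "alive (D'(adj j := 1)) = alive D' - {adj j}" by (auto simp: alive_def)
      moreover have "adj j \<in> alive D'" using True wn by (simp add: alive_def)
      then have "adj j \<in> alive D" using D'(2) by (auto simp: R_def)
      ultimately have R': "R (insert (adj j) ?X) (D'(adj j := 1)) (adj j)"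
        using D'(2) w by (auto simp: R_def)
      show ?thesis
      proof (rule wp_loop_free)
        show "vars (run ?body t) ''j'' = j \<and> ?I (Suc j) (set_var ''j'' (Suc j) (run ?body t))"
          unfolding X
          by (intro conjI exI[of _ "D'(adj j := 1)"] exI[of _ "adj j"])
            (use t D'(1) R' True in \<open>simp_all add: elim_state_def holds_input_def\<close>)
      qed simp_all
    next
      case False
      then have "adj j \<notin> alive D'" by (simp add: alive_def)
      then have R': "R (insert (adj j) ?X) D' p"
        using D'(2) wn by (auto simp: R_def)
      show ?thesis
      proof (rule wp_loop_free)
        show "vars (run ?body t) ''j'' = j \<and> ?I (Suc j) (set_var ''j'' (Suc j) (run ?body t))"
          unfolding X
          by (intro conjI exI[of _ D'] exI[of _ p])
            (use t D'(1) R' False in \<open>simp_all add: elim_state_def holds_input_def\<close>)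
      qed simp_all
    qed
  qed
  have loop: "wp ?loop (10 + 24 * off n) (?I (off (Suc b))) t"
    if t: "elim_state r L (D(b := 1)) (Q(l := b)) P l t" "vars t ''b'' = b" for t
  proof (rule wp_For[where I = ?I and l = "off b" and h = "off (Suc b)" and b = "\<lambda>_. 14"])
    \<comment> \<open>Before the first hit \<open>p\<close> is the old entry \<open>P l\<close>, for
      which the update of \<open>P\<close> changes nothing.\<close>
    have "R {} (D(b := 1)) (P l)" by (auto simp: R_def alive_def)
    then show "?I (off b) (set_var ''j'' (off b) t)"
      using t by (auto simp: elim_state_def holds_input_def intro!: exI[of _ "D(b := 1)"] exI[of _ "P l"])
  next
    show "10 + (\<Sum>k = off b..<off (Suc b). 14 + 10) \<le> 10 + 24 * off n"
      using off_diff_le[OF bn] by simp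
  next
    fix j t assume "off b \<le> j" "j < off (Suc b)" "?I j t"
    then show "wp ?body 14 (\<lambda>t. vars t ''j'' = j \<and> ?I (Suc j) (set_var ''j'' (Suc j) t)) t"
      by (rule body)
  qed (use t off_mono[OF bn] in \<open>auto simp: elim_state_def holds_input_def\<close>)
  have post: "wp (Assign ''len'' (Succ (Var ''len''))) 3
      (\<lambda>t. \<exists>D' u. u \<in> nbhd E b \<inter> alive D \<and> alive D' = alive D - insert b (nbhd E b) \<and>
       elim_state r L D' (Q(l := b)) (P(l := u)) (Suc l) t) t" if t: "?I (off (Suc b)) t" for t
  proof -
    obtain D' p where D': "elim_state r L D' (Q(l := b)) (P(l := p)) l t" "R (nbhd E b) D' p"
      using t adj_image[OF bn] by auto
    have "p \<in> nbhd E b \<inter> alive D \<and> alive D' = alive D - insert b (nbhd E b) \<and>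
       elim_state r L D' (Q(l := b)) (P(l := p)) (Suc l) (run (Assign ''len'' (Succ (Var ''len''))) t)"
      using D' b by (simp add: R_def elim_state_def holds_input_def)
    then show ?thesis by (intro wp_loop_free) (simp_all, blast)
  qed
  have "wp remove_neighbourhood (1 + cost_test (Less (Const 0) (Var ''bl'')) +
      (6 + (10 + 24 * off n + 3)))
    (\<lambda>t. \<exists>D' u. u \<in> nbhd E b \<inter> alive D \<and> alive D' = alive D - insert b (nbhd E b) \<and>
       elim_state r L D' (Q(l := b)) (P(l := u)) (Suc l) t) s"
    unfolding remove_neighbourhood_def
    by (rule wp_Cond, rule wp_Seq, rule wp_loop_free, simp, simp, rule wp_Seq,
        rule wp_mono[OF loop order_refl post])
      (use s bl in \<open>simp_all add: elim_state_def holds_input_def\<close>)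
  then show ?thesis by (rule wp_mono) simp_all
qed

section \<open>The elimination invariant and optimality\<close>

definition edgeless :: "nat set \<Rightarrow> bool" where
  "edgeless W \<longleftrightarrow> (\<forall>v\<in>W. nbhd E v \<inter> W = {})"

text \<open>The last conjunct bounds the number of rounds: unless the remaining graph is edgeless,
  every round removes vertices.\<close>

definition elim_inv :: "nat \<Rightarrow> (nat \<Rightarrow> nat) \<Rightarrow> (nat \<Rightarrow> nat) \<Rightarrow> (nat \<Rightarrow> nat) \<Rightarrow> nat \<Rightarrow> bool" where
  "elim_inv k D Q P l \<longleftrightarrow> l \<le> k \<and>
     (\<forall>vs. legal_from E (alive D) {} vs \<longrightarrow>
        legal_from E {..<n} {} (map Q [0..<l] @ vs @ rev (map P [0..<l]))) \<and>
     (\<forall>vs. legal_from E {..<n} {} vs \<longrightarrow>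
        (\<exists>vs'. legal_from E (alive D) {} vs' \<and> length vs \<le> length vs' + 2 * l)) \<and>
     (edgeless (alive D) \<or> card (alive D) + k \<le> n)"

lemma elim_inv_edgeless: "elim_inv k D Q P l \<Longrightarrow> edgeless (alive D) \<Longrightarrow> elim_inv (Suc k) D Q P l"
  by (auto simp: elim_inv_def)

text \<open>\<open>b\<close> is extremal among all vertices alive, so its neighbours are twins. Then
  \<open>legal_from_extend\<close> puts \<open>b\<close> and \<open>u\<close> inside the brackets of
  the earlier rounds, and \<open>legal_from_reduce\<close> adds a loss of two to the upper
  bound.\<close>

lemma elim_inv_step:
  assumes lv: "levelled_graph {..<n} E L" and inv: "elim_inv k D Q P l"
    and best: "best L (alive D) n b bl bc" "0 < bl"
    and u: "u \<in> nbhd E b \<inter> alive D" and D': "alive D' = alive D - insert b (nbhd E b)"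
  shows "elim_inv (Suc k) D' (Q(l := b)) (P(l := u)) (Suc l)"
proof -
  let ?W = "alive D"
  have fin: "finite ?W" by (simp add: alive_def)
  have b: "b \<in> ?W" "bl = L b" "bc = card (nbhd E b \<inter> ?W)"
    and ext: "\<And>v. v \<in> ?W \<Longrightarrow> nbhd E v \<inter> ?W \<noteq> {} \<Longrightarrow> L v < bl \<or> L v = bl \<and> bc \<le> card (nbhd E v \<inter> ?W)"
    using best by (auto simp: best_def alive_def)
  have tw: "twin_neighbours {..<n} E ?W b u"
  proof
    fix y y' assume "y \<in> nbhd E b \<inter> ?W" "y' \<in> nbhd E b \<inter> ?W"
    then show "nbhd E y \<inter> ?W \<subseteq> nbhd E y' \<inter> ?W"
      using levelled_graph.extremal_neighbours_twins[OF lv, of ?W b y y'] b ext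
      by (force simp: alive_def)
  qed (use simple b u in auto)
  interpret twin_neighbours "{..<n}" E ?W b u by (rule tw)
  have rest: "alive D' = rest" using D' by (simp add: rest_def)
  have "legal_from E {..<n} {} (map (Q(l := b)) [0..<Suc l] @ vs @ rev (map (P(l := u)) [0..<Suc l]))"
    if "legal_from E (alive D') {} vs" for vs
  proof -
    have "legal_from E ?W {} (b # vs @ [u])" using legal_from_extend that rest by simp
    then have "legal_from E {..<n} {} (map Q [0..<l] @ (b # vs @ [u]) @ rev (map P [0..<l]))"
      using inv unfolding elim_inv_def by blast
    moreover have "map (Q(l := b)) [0..<l] = map Q [0..<l]" "map (P(l := u)) [0..<l] = map P [0..<l]"
      by (auto intro: map_cong)
    ultimately show ?thesis by simp
  qed
  moreover have "\<exists>vs'. legal_from E (alive D') {} vs' \<and> length vs \<le> length vs' + 2 * Suc l"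
    if vs: "legal_from E {..<n} {} vs" for vs
  proof -
    obtain vs1 where "legal_from E ?W {} vs1" "length vs \<le> length vs1 + 2 * l"
      using inv vs unfolding elim_inv_def by blast
    moreover from this obtain vs2 where "legal_from E rest {} vs2" "length vs1 \<le> length vs2 + 2"
      using legal_from_reduce by blast
    ultimately show ?thesis using rest by (intro exI[of _ vs2]) simp
  qed
  moreover have "card (alive D') + Suc k \<le> n"
  proof -
    have "alive D' \<subset> ?W" using D' b by blast
    then have "card (alive D') < card ?W" using fin by (simp add: psubset_card_mono)
    \<comment> \<open>\<open>b\<close> and \<open>u\<close> span an edge, so the invariant must hold
      by its counting alternative.\<close>
    moreover have "\<not> edgeless ?W" using u b by (auto simp: edgeless_def)
    then have "card ?W + k \<le> n" using inv by (simp add: elim_inv_def)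
    ultimately show ?thesis by simp
  qed
  ultimately show ?thesis using inv unfolding elim_inv_def by simp
qed

lemma elim_round_correct:
  assumes lv: "levelled_graph {..<n} E L" and L: "\<And>v. v < n \<Longrightarrow> 0 < L v"
    and s: "elim_state k L D Q P l s" and inv: "elim_inv k D Q P l"
  shows "wp (Seq select_vertex remove_neighbourhood) ((12 + 60 * n + 19 * off n) + (23 + 24 * off n))
    (\<lambda>t. \<exists>D Q P l. elim_state k L D Q P l t \<and> elim_inv (Suc k) D Q P l) s"
proof (rule wp_Seq, rule wp_mono[OF select_vertex_correct[OF s L] order_refl])
  fix t assume "elim_state k L D Q P l t \<and>
       best L (alive D) n (vars t ''b'') (vars t ''bl'') (vars t ''bc'')"
  then have t: "elim_state k L D Q P l t"
    and best: "best L (alive D) n (vars t ''b'') (vars t ''bl'') (vars t ''bc'')" by auto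
  show "wp remove_neighbourhood (23 + 24 * off n)
    (\<lambda>t. \<exists>D Q P l. elim_state k L D Q P l t \<and> elim_inv (Suc k) D Q P l) t"
  proof (cases "vars t ''bl'' = 0")
    \<comment> \<open>Nothing is left to eliminate; the round is idle and only the counter
      advances.\<close>
    case True
    then have "edgeless (alive D)" using best by (auto simp: best_def edgeless_def alive_def)
    then have "elim_inv (Suc k) D Q P l" using inv by (rule elim_inv_edgeless[rotated])
    then have "\<exists>D Q P l. elim_state k L D Q P l (run Skip t) \<and> elim_inv (Suc k) D Q P l"
      using t unfolding run.simps by blast
    note skip = wp_loop_free[of Skip 1 "\<lambda>t. \<exists>D Q P l. elim_state k L D Q P l t \<and> elim_inv (Suc k) D Q P l",
      OF _ _ this]
    have "wp remove_neighbourhood (1 + cost_test (Less (Const 0) (Var ''bl'')) + 1)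
      (\<lambda>t. \<exists>D Q P l. elim_state k L D Q P l t \<and> elim_inv (Suc k) D Q P l) t"
      unfolding remove_neighbourhood_def
      by (rule wp_Cond, simp add: True) (rule skip, simp_all)
    then show ?thesis by (rule wp_mono) simp_all
  next
    case False
    then have pos: "0 < vars t ''bl''" by simp
    have b: "vars t ''b'' \<in> alive D" "nbhd E (vars t ''b'') \<inter> alive D \<noteq> {}"
      using best pos by (simp_all add: best_def)
    show ?thesis
    proof (rule wp_mono[OF remove_neighbourhood_correct[OF t refl refl pos b] order_refl])
      fix t'
      assume "\<exists>D' u. u \<in> nbhd E (vars t ''b'') \<inter> alive D \<and>
        alive D' = alive D - insert (vars t ''b'') (nbhd E (vars t ''b'')) \<and>
        elim_state k L D' (Q(l := vars t ''b'')) (P(l := u)) (Suc l) t'"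
      then obtain D' u where D': "u \<in> nbhd E (vars t ''b'') \<inter> alive D"
        "alive D' = alive D - insert (vars t ''b'') (nbhd E (vars t ''b''))"
        "elim_state k L D' (Q(l := vars t ''b'')) (P(l := u)) (Suc l) t'" by blast
      show "\<exists>D Q P l. elim_state k L D Q P l t' \<and> elim_inv (Suc k) D Q P l"
        using D'(3) elim_inv_step[OF lv inv best pos D'(1,2)] by blast
    qed
  qed
qed

lemma eliminate_correct:
  assumes lv: "levelled_graph {..<n} E L" and L: "\<And>v. v < n \<Longrightarrow> 0 < L v"
    and s: "level_state d L s"
  shows "wp eliminate (2 + (10 + n * (45 + 60 * n + 43 * off n)))
    (\<lambda>t. \<exists>D Q P l. elim_state n L D Q P l t \<and> elim_inv n D Q P l) s"
  unfolding eliminate_def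
proof (rule wp_Seq, rule wp_loop_free, simp, simp, rule wp_For[where l = 0 and h = n and
      b = "\<lambda>_. (12 + 60 * n + 19 * off n) + (23 + 24 * off n)" and
      I = "\<lambda>k t. \<exists>D Q P l. elim_state k L D Q P l t \<and> elim_inv k D Q P l"])
  have "alive (\<lambda>_. 0) = {..<n}" by (auto simp: alive_def)
  then have "elim_inv 0 (\<lambda>_. 0) Q P 0" for Q P by (auto simp: elim_inv_def)
  moreover have "elim_state 0 L (\<lambda>_. 0) (arrs s ''seq'') (arrs s ''sup'') 0
      (set_var ''k'' 0 (run (Assign ''len'' (Const 0)) s))"
    using s by (simp add: level_state_def elim_state_def holds_input_def)
  ultimately show "\<exists>D Q P l. elim_state 0 L D Q P l (set_var ''k'' 0 (run (Assign ''len'' (Const 0)) s)) \<and>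
      elim_inv 0 D Q P l"
    by blast
next
  fix k t assume "\<exists>D Q P l. elim_state k L D Q P l t \<and> elim_inv k D Q P l"
  then obtain D Q P l where t: "elim_state k L D Q P l t" "elim_inv k D Q P l" by blast
  have Suc: "elim_state k L D Q P l t \<Longrightarrow> vars t ''k'' = k \<and> elim_state (Suc k) L D Q P l (set_var ''k'' (Suc k) t)"
    for D Q P l t by (simp add: elim_state_def holds_input_def)
  show "wp (Seq select_vertex remove_neighbourhood) ((12 + 60 * n + 19 * off n) + (23 + 24 * off n))
      (\<lambda>t. vars t ''k'' = k \<and> (\<exists>D Q P l. elim_state (Suc k) L D Q P l (set_var ''k'' (Suc k) t) \<and>
        elim_inv (Suc k) D Q P l)) t"
    by (rule wp_mono[OF elim_round_correct[OF lv L t] order_refl]) (use Suc in blast)+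
qed (auto simp: elim_state_def holds_input_def algebra_simps)

text \<open>After \<open>n\<close> rounds the counting alternative leaves no vertex alive, and the
  empty graph is edgeless.\<close>

lemma elim_inv_edgeless_final: "elim_inv n D Q P l \<Longrightarrow> edgeless (alive D)"
  by (auto simp: elim_inv_def alive_def edgeless_def)

text \<open>In an edgeless remainder only the empty sequence is legal. The invariant extends it to a
  legal sequence of length \<open>2 * l\<close> and shows that none is longer.\<close>

lemma elim_inv_final:
  assumes inv: "elim_inv n D Q P l"
  shows "grundy_total_dom_seq {..<n} E (map Q [0..<l] @ rev (map P [0..<l]))"
proof -
  let ?vs = "map Q [0..<l] @ rev (map P [0..<l])"
  have no: "vs = []" if "legal_from E (alive D) {} vs" for vs
    using that elim_inv_edgeless_final[OF inv] by (cases vs) (auto simp: edgeless_def)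
  have "legal_from E (alive D) {} []" by simp
  then have "legal_from E {..<n} {} (map Q [0..<l] @ [] @ rev (map P [0..<l]))"
    using inv unfolding elim_inv_def by blast
  then have legal: "legal_seq {..<n} E ?vs" by (simp add: legal_seq_iff_legal_from[OF simple])
  have upper: "length vs \<le> 2 * l" if "legal_seq {..<n} E vs" for vs
    using that inv no unfolding legal_seq_iff_legal_from[OF simple] elim_inv_def by fastforce
  have "Max {length vs | vs. legal_seq {..<n} E vs} = 2 * l"
  proof (rule Max_eqI)
    show "finite {length vs | vs. legal_seq {..<n} E vs}"
      by (rule finite_subset[of _ "{..2 * l}"]) (use upper in auto)
    show "2 * l \<in> {length vs | vs. legal_seq {..<n} E vs}"
      using legal by (intro CollectI exI[of _ ?vs]) simp
  qed (use upper in auto)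
  then show ?thesis using legal by (simp add: grundy_total_dom_seq_def grundy_total_number_def)
qed

section \<open>Output and total running time\<close>

lemma append_supports_correct:
  assumes s: "elim_state k L D Q P l s" and l: "l \<le> n"
  shows "wp append_supports (12 + 20 * n)
    (\<lambda>t. seq_output t = map Q [0..<l] @ rev (map P [0..<l])) s"
proof -
  let ?I = "\<lambda>j t. vars t ''j'' = j \<and> vars t ''m'' = l \<and> vars t ''len'' = l + j \<and> arrs t ''sup'' = P \<and>
     seq_output t = map Q [0..<l] @ map (\<lambda>i. P (l - Suc i)) [0..<j]"
  let ?body = "Seq (Store ''seq'' (Var ''len'') (Elem ''sup'' (Minus (Var ''m'') (Succ (Var ''j'')))))
        (Assign ''len'' (Succ (Var ''len'')))"
  have rev: "map (\<lambda>i. P (l - Suc i)) [0..<l] = rev (map P [0..<l])"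
    by (rule nth_equalityI) (auto simp: rev_nth)
  have loop: "wp (For ''j'' (Const 0) (Var ''m'') ?body) (10 + 20 * n) (?I l) t"
    if t: "elim_state k L D Q P l t" "vars t ''m'' = l" for t
  proof (rule wp_For[where I = ?I and l = 0 and h = l and b = "\<lambda>_. 10"])
    fix j t assume "?I j t"
    then show "wp ?body 10 (\<lambda>t. vars t ''j'' = j \<and> ?I (Suc j) (set_var ''j'' (Suc j) t)) t"
      by (intro wp_loop_free) (auto simp add: seq_output_def)
  qed (use t l in \<open>auto simp: elim_state_def seq_output_def\<close>)
  have "wp append_supports (2 + (10 + 20 * n)) (?I l) s"
    unfolding append_supports_def
    by (rule wp_Seq, rule wp_loop_free, simp, simp, rule loop)
      (use s in \<open>simp_all add: elim_state_def holds_input_def\<close>)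
  then show ?thesis by (rule wp_mono) (simp_all add: rev)
qed

lemma grundy_program_correct:
  assumes bdh: "bipartite_distance_hereditary {..<n} E" and s: "graph_input n E s"
    and arrays: "off = arrs s ''off''" "adj = arrs s ''adj''"
  shows "wp grundy_program (300 * (n * (n + card E) + 1))
    (\<lambda>t. grundy_total_dom_seq {..<n} E (seq_output t)) s"
proof -
  let ?T1 = "10 + n * (75 * n + 21 * off n + 70)" and ?T2 = "2 + (10 + n * (45 + 60 * n + 43 * off n))"
  have init: "holds_input s" "arrs s ''lev'' = (\<lambda>_. 0)" "arrs s ''del'' = (\<lambda>_. 0)"
    using s by (simp_all add: graph_input_def holds_input_def arrays[symmetric])
  have phase2: "wp (Seq eliminate append_supports) (?T2 + (12 + 20 * n))
    (\<lambda>t. grundy_total_dom_seq {..<n} E (seq_output t)) t"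
    if t: "\<exists>L. partial_levels (Suc n) L \<and> level_state (Suc n) L t" for t
  proof -
    obtain L where L: "partial_levels (Suc n) L" "level_state (Suc n) L t"
      using t by blast
    note elim = eliminate_correct[OF partial_levels_levelled_graph[OF L(1) bdh]
      partial_levels_complete[OF L(1)] L(2)]
    show ?thesis
    proof (rule wp_Seq, rule wp_mono[OF elim order_refl])
      fix t assume "\<exists>D Q P l. elim_state n L D Q P l t \<and> elim_inv n D Q P l"
      then obtain D Q P l where t: "elim_state n L D Q P l t" and inv: "elim_inv n D Q P l" by blast
      then have "l \<le> n" by (simp add: elim_inv_def)
      then show "wp append_supports (12 + 20 * n)
          (\<lambda>t. grundy_total_dom_seq {..<n} E (seq_output t)) t"
        by (rule wp_mono[OF append_supports_correct[OF t]]) (simp_all add: elim_inv_final[OF inv])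
    qed
  qed
  have "wp grundy_program (?T1 + (?T2 + (12 + 20 * n)))
    (\<lambda>t. grundy_total_dom_seq {..<n} E (seq_output t)) s"
    unfolding grundy_program_def
    by (rule wp_Seq, rule wp_mono[OF compute_levels_correct[OF init] order_refl phase2])
  moreover have "?T1 + (?T2 + (12 + 20 * n)) \<le> 300 * (n * (n + card E) + 1)"
  proof -
    \<comment> \<open>Linear terms are absorbed by \<open>n * n\<close>, and \<open>off n\<close> by
      twice the number of edges; the additive 300 pays for the constant work, in particular when
      \<open>n\<close> is 0.\<close>
    have "n \<le> n * n" by simp
    moreover have "n * off n \<le> 2 * (n * card E)"
      using mult_le_mono2[OF off_le_card_edges, of n] by (simp add: mult.left_commute)
    moreover have "?T1 + (?T2 + (12 + 20 * n)) = 34 + 135 * (n * n) + 64 * (n * off n) + 135 * n"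
      by (simp add: algebra_simps)
    moreover have "300 * (n * (n + card E) + 1) = 300 * (n * n) + 300 * (n * card E) + 300"
      by (simp add: algebra_simps)
    ultimately show ?thesis by linarith
  qed
  ultimately show ?thesis by (rule wp_mono)
qed

end

theorem theorem5p2:
  "\<exists>(alg :: com) (K :: nat). \<forall>(n :: nat) (E :: nat set set) (s :: state).
     simple_graph {..<n} E \<longrightarrow> bipartite_distance_hereditary {..<n} E \<longrightarrow> graph_input n E s \<longrightarrow>
     (\<exists>T t. exec alg s T t \<and>
        grundy_total_dom_seq {..<n} E (seq_output t) \<and>
        T \<le> K * (n * (n + card E) + 1))"
proof (rule exI[of _ grundy_program], rule exI[of _ 300], intro allI impI)
  fix n E s
  assume g: "simple_graph {..<n} E" "bipartite_distance_hereditary {..<n} E" and s: "graph_input n E s"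
  interpret adjacency_lists n E "arrs s ''off''" "arrs s ''adj''"
    by unfold_locales (use g s in \<open>auto simp: graph_input_def\<close>)
  show "\<exists>T t. exec grundy_program s T t \<and> grundy_total_dom_seq {..<n} E (seq_output t) \<and>
      T \<le> 300 * (n * (n + card E) + 1)"
    using grundy_program_correct[OF g(2) s refl refl] unfolding wp_def by blast
qed

end
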